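(* Let $X$ be a compact metric space, $\mu$ a Borel probability measure on $X$, and $T:X\to X$ a measurable map that is non-singular with respect to $\mu$, with Perron--Frobenius operator $\mathcal{T}:L^1_\mu(X)\to L^1_\mu(X)$. Let $\{\{C_{i,n}\}_{i=1}^n\}_{n=1}^\infty$ be a sequence of measurable partitions of $X$ such that $C_{i,n}\cap C_{j,n}=\emptyset$ for $i\ne j$, $\bigcup_{i=1}^n C_{i,n}=X$, $\mu(C_{i,n})>0$ for all $n\in\mathbb{N}$ and $1\le i\le n$, and $\lim_{n\to\infty}\max_{1\le i\le n}\operatorname{diam}(C_{i,n})=0$. For every $\varepsilon>0$, $n\in\mathbb{N}$ and $1\le i\le n$, let $\psi^{(\varepsilon)}_{i,n}\in L^1_\mu(X)\cap L^\infty_\mu(X)$ be functions on $X$ such that $\psi^{(\varepsilon)}_{i,n}(x)\ge 0$ and $\sum_{i=1}^n\psi^{(\varepsilon)}_{i,n}(x)=1$ for all $x \in X$, and such that for each $n\in\mathbb{N}$ and $i\le n$, $\psi^{(\varepsilon)}_{i,n}\to\chi_{C_{i,n}}$ pointwise $\mu$-a.e. as $\varepsilon\to 0$. Let $\mathcal{T}^{(n,\varepsilon)}=\mathcal{L}^{(n,\varepsilon)}\mathcal{Q}^{(n)}:L^1_\mu(X)\to L^1_\mu(X)$ be the regularized approximation defined in the context. Then for every fixed $\varepsilon>0$ and $n\in\mathbb{N}$, the operator $\mathcal{T}^{(n,\varepsilon)}$ is Markov. Moreover, $$\lim_{n\to\infty}\lim_{\varepsilon\to 0}\|\mathcal{T}^{(n,\varepsilon)}f-\mathcal{T}f\|_{L^1_\mu}=0\qquad\text{for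 all } f\in L^1_\mu(X).$$
   Context: Here $\varepsilon\to0$ means $\varepsilon\to 0^+$, and $\chi_B$ is the characteristic function of $B$. $\langle f_1,f_2\rangle_\mu:=\int_X f_1f_2\,d\mu$. Non-singular: for measurable $B$, $\mu(B)=0$ implies $\mu(T^{-1}(B))=0$. The Perron--Frobenius operator of $T$ is the unique linear operator $\mathcal{T}:L^1_\mu(X)\to L^1_\mu(X)$ with $\int_B\mathcal{T}f\,d\mu=\int_{T^{-1}(B)}f\,d\mu$ for all measurable $B$ and all $f\in L^1_\mu(X)$. A linear operator $P$ on $L^1_\mu(X)$ is Markov if it preserves nonnegativity and total mass: $f\ge0$ implies $Pf\ge 0$ and $\int_X Pf\,d\mu=\int_X f\,d\mu$. Set $\phi_{i,n}:=\chi_{C_{i,n}}/\mu(C_{i,n})$ and $\Delta_n:=\operatorname{span}\{\phi_{1,n},\dots,\phi_{n,n}\}\subseteq L^1_\mu(X)$. Define $\mathcal{Q}^{(n)}:L^1_\mu(X)\to\Delta_n$ by $$\mathcal{Q}^{(n)}f:=\sum_{i=1}^n\frac{\langle f,\chi_{C_{i,n}}\rangle_\mu}{\langle\chi_{C_{i,n}},\chi_{C_{i,n}}\rangle_\mu}\chi_{C_{i,n}}.$$ Define the linear map $\mathcal{L}^{(n,\varepsilon)}:\Delta_n\to\Delta_n$ by $$\mathcal{L}^{(n,\varepsilon)}\phi_{i,n}:=\sum_{j=1}^n M^{(n,\varepsilon)}_{i,j}\phi_{j,n},\qquad M^{(n,\varepsilon)}_{i,j}:=\frac{\langle\psi^{(\varepsilon)}_{j,n}\circ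 T,\chi_{C_{i,n}}\rangle_\mu}{\langle\chi_{C_{i,n}},\chi_{C_{i,n}}\rangle_\mu}.$$ *)

theory Defs
  imports "HOL-Probability.Probability"
begin

section \<open>Operators on $L^1$\<close>

text \<open>
  Elements of $L^1_\mu(X)$ are represented by functions \<open>f\<close> with \<open>integrable \<mu> f\<close>, and equality in
  $L^1_\mu(X)$ is equality \<open>\<mu>\<close>-almost everywhere.  Accordingly an operator on $L^1_\mu(X)$ is a map on
  functions that preserves integrability and almost-everywhere equality, and linearity is required
  almost everywhere.  Values at non-integrable functions are irrelevant.
\<close>

definition L1_operator :: "'a measure \<Rightarrow> (('a \<Rightarrow> real) \<Rightarrow> ('a \<Rightarrow> real)) \<Rightarrow> bool" where
  "L1_operator \<mu> P \<longleftrightarrow>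
     (\<forall>f. integrable \<mu> f \<longrightarrow> integrable \<mu> (P f)) \<and>
     (\<forall>f g. integrable \<mu> f \<longrightarrow> integrable \<mu> g \<longrightarrow> (AE x in \<mu>. f x = g x) \<longrightarrow> (AE x in \<mu>. P f x = P g x))"

definition L1_linear_operator :: "'a measure \<Rightarrow> (('a \<Rightarrow> real) \<Rightarrow> ('a \<Rightarrow> real)) \<Rightarrow> bool" where
  "L1_linear_operator \<mu> P \<longleftrightarrow>
     L1_operator \<mu> P \<and>
     (\<forall>f g. integrable \<mu> f \<longrightarrow> integrable \<mu> g \<longrightarrow>
        (AE x in \<mu>. P (\<lambda>y. f y + g y) x = P f x + P g x)) \<and>
     (\<forall>c f. integrable \<mu> f \<longrightarrow> (AE x in \<mu>. P (\<lambda>y. c * f y) x = c * P f x))"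

definition markov_operator :: "'a measure \<Rightarrow> (('a \<Rightarrow> real) \<Rightarrow> ('a \<Rightarrow> real)) \<Rightarrow> bool" where
  "markov_operator \<mu> P \<longleftrightarrow>
     L1_linear_operator \<mu> P \<and>
     (\<forall>f. integrable \<mu> f \<longrightarrow> (AE x in \<mu>. 0 \<le> f x) \<longrightarrow> (AE x in \<mu>. 0 \<le> P f x)) \<and>
     (\<forall>f. integrable \<mu> f \<longrightarrow> (LINT x|\<mu>. P f x) = (LINT x|\<mu>. f x))"

definition L1_norm :: "'a measure \<Rightarrow> ('a \<Rightarrow> real) \<Rightarrow> real" where
  "L1_norm \<mu> f = (LINT x|\<mu>. \<bar>f x\<bar>)"

definition L_infinity :: "'a measure \<Rightarrow> ('a \<Rightarrow> real) set" where
  "L_infinity \<mu> = {f \<in> borel_measurable \<mu>. esssup \<mu> (\<lambda>x. ereal \<bar>f x\<bar>) < \<infinity>}"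

definition L2_pairing :: "'a measure \<Rightarrow> ('a \<Rightarrow> real) \<Rightarrow> ('a \<Rightarrow> real) \<Rightarrow> real" where
  "L2_pairing \<mu> f g = (LINT x|\<mu>. f x * g x)"


section \<open>Non-singular maps and the Perron--Frobenius operator\<close>

definition nonsingular :: "'a measure \<Rightarrow> ('a \<Rightarrow> 'a) \<Rightarrow> bool" where
  "nonsingular \<mu> T \<longleftrightarrow>
     (\<forall>B \<in> sets \<mu>. emeasure \<mu> B = 0 \<longrightarrow> emeasure \<mu> (T -` B \<inter> space \<mu>) = 0)"

text \<open>
  The Perron--Frobenius operator is given by its characterising property; it exists and is unique up
  to almost-everywhere equality, see \<open>perron_frobenius_exists\<close> and \<open>perron_frobenius_unique\<close> below.
\<close>

definition perron_frobenius ::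
  "'a measure \<Rightarrow> ('a \<Rightarrow> 'a) \<Rightarrow> (('a \<Rightarrow> real) \<Rightarrow> ('a \<Rightarrow> real)) \<Rightarrow> bool" where
  "perron_frobenius \<mu> T P \<longleftrightarrow>
     L1_linear_operator \<mu> P \<and>
     (\<forall>f. integrable \<mu> f \<longrightarrow>
        (\<forall>B \<in> sets \<mu>. (LINT x:B|\<mu>. P f x) = (LINT x:(T -` B \<inter> space \<mu>)|\<mu>. f x)))"


section \<open>The regularised approximation\<close>

text \<open>
  A family of partitions is a function \<open>C\<close> where \<open>C i n\<close> is $C_{i,n}$ for \<open>1 \<le> i \<le> n\<close>, and
  \<open>\<psi> \<epsilon> i n\<close> is $\psi^{(\varepsilon)}_{i,n}$.
\<close>

definition phi :: "'a measure \<Rightarrow> (nat \<Rightarrow> nat \<Rightarrow> 'a set) \<Rightarrow> nat \<Rightarrow> nat \<Rightarrow> 'a \<Rightarrow> real" where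
  "phi \<mu> C i n = (\<lambda>x. indicator (C i n) x / measure \<mu> (C i n))"

definition Delta :: "'a measure \<Rightarrow> (nat \<Rightarrow> nat \<Rightarrow> 'a set) \<Rightarrow> nat \<Rightarrow> ('a \<Rightarrow> real) set" where
  "Delta \<mu> C n = {g. integrable \<mu> g \<and> (\<exists>a. AE x in \<mu>. g x = (\<Sum>i=1..n. a i * phi \<mu> C i n x))}"

text \<open>
  The coordinates of \<open>g \<in> Delta \<mu> C n\<close> with respect to the basis \<open>phi \<mu> C 1 n, \<dots>, phi \<mu> C n n\<close>.
  The condition outside \<open>{1..n}\<close> only makes the coordinate function unique.
\<close>

definition Delta_coords ::
  "'a measure \<Rightarrow> (nat \<Rightarrow> nat \<Rightarrow> 'a set) \<Rightarrow> nat \<Rightarrow> ('a \<Rightarrow> real) \<Rightarrow> nat \<Rightarrow> real" where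
  "Delta_coords \<mu> C n g =
     (THE a. (\<forall>i. i \<notin> {1..n} \<longrightarrow> a i = 0) \<and> (AE x in \<mu>. g x = (\<Sum>i=1..n. a i * phi \<mu> C i n x)))"

definition Qop :: "'a measure \<Rightarrow> (nat \<Rightarrow> nat \<Rightarrow> 'a set) \<Rightarrow> nat \<Rightarrow> ('a \<Rightarrow> real) \<Rightarrow> 'a \<Rightarrow> real" where
  "Qop \<mu> C n f =
     (\<lambda>x. \<Sum>i=1..n. L2_pairing \<mu> f (indicator (C i n))
                     / L2_pairing \<mu> (indicator (C i n)) (indicator (C i n)) * indicator (C i n) x)"

definition Mmat ::
  "'a measure \<Rightarrow> ('a \<Rightarrow> 'a) \<Rightarrow> (nat \<Rightarrow> nat \<Rightarrow> 'a set) \<Rightarrow> (real \<Rightarrow> nat \<Rightarrow> nat \<Rightarrow> 'a \<Rightarrow> real) \<Rightarrow>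
   nat \<Rightarrow> real \<Rightarrow> nat \<Rightarrow> nat \<Rightarrow> real" where
  "Mmat \<mu> T C \<psi> n \<epsilon> i j =
     L2_pairing \<mu> (\<psi> \<epsilon> j n \<circ> T) (indicator (C i n))
       / L2_pairing \<mu> (indicator (C i n)) (indicator (C i n))"

text \<open>
  The linear extension of $\phi_{i,n} \mapsto \sum_j M^{(n,\varepsilon)}_{i,j} \phi_{j,n}$ to \<open>Delta \<mu> C n\<close>;
  values outside \<open>Delta \<mu> C n\<close> are irrelevant.
\<close>

definition Lop ::
  "'a measure \<Rightarrow> ('a \<Rightarrow> 'a) \<Rightarrow> (nat \<Rightarrow> nat \<Rightarrow> 'a set) \<Rightarrow> (real \<Rightarrow> nat \<Rightarrow> nat \<Rightarrow> 'a \<Rightarrow> real) \<Rightarrow>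
   nat \<Rightarrow> real \<Rightarrow> ('a \<Rightarrow> real) \<Rightarrow> 'a \<Rightarrow> real" where
  "Lop \<mu> T C \<psi> n \<epsilon> g =
     (\<lambda>x. \<Sum>i=1..n. Delta_coords \<mu> C n g i * (\<Sum>j=1..n. Mmat \<mu> T C \<psi> n \<epsilon> i j * phi \<mu> C j n x))"

definition reg_approx ::
  "'a measure \<Rightarrow> ('a \<Rightarrow> 'a) \<Rightarrow> (nat \<Rightarrow> nat \<Rightarrow> 'a set) \<Rightarrow> (real \<Rightarrow> nat \<Rightarrow> nat \<Rightarrow> 'a \<Rightarrow> real) \<Rightarrow>
   nat \<Rightarrow> real \<Rightarrow> ('a \<Rightarrow> real) \<Rightarrow> 'a \<Rightarrow> real" where
  "reg_approx \<mu> T C \<psi> n \<epsilon> = Lop \<mu> T C \<psi> n \<epsilon> \<circ> Qop \<mu> C n"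


section \<open>The definitions are well posed\<close>

lemma perron_frobenius_unique:
  assumes "perron_frobenius \<mu> T P" "perron_frobenius \<mu> T P'" "integrable \<mu> f"
  shows "AE x in \<mu>. P f x = P' f x"
  using assms unfolding perron_frobenius_def L1_linear_operator_def L1_operator_def
  by (intro density_unique_real) auto

lemma perron_frobenius_image_nonneg:
  fixes f :: "'a \<Rightarrow> real"
  assumes "prob_space \<mu>" and T[measurable]: "T \<in> measurable \<mu> \<mu>" and ns: "nonsingular \<mu> T"
    and f: "integrable \<mu> f" and nn: "\<And>x. 0 \<le> f x"
  shows "\<exists>g. integrable \<mu> g \<and>
     (\<forall>B \<in> sets \<mu>. (LINT x:B|\<mu>. g x) = (LINT x:(T -` B \<inter> space \<mu>)|\<mu>. f x))"
proof -
  interpret prob_space \<mu> by fact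
  have [measurable]: "f \<in> borel_measurable \<mu>" using f by auto
  define N where "N = distr (density \<mu> (\<lambda>x. ennreal (f x))) \<mu> T"
  have emN: "emeasure N B = (\<integral>\<^sup>+x. ennreal (f x) * indicator (T -` B \<inter> space \<mu>) x \<partial>\<mu>)"
    if [measurable]: "B \<in> sets \<mu>" for B
    unfolding N_def by (simp add: emeasure_distr emeasure_density)
  have ac: "absolutely_continuous \<mu> N"
    unfolding absolutely_continuous_def
  proof
    fix B assume B: "B \<in> null_sets \<mu>"
    then have [measurable]: "B \<in> sets \<mu>" by auto
    have "T -` B \<inter> space \<mu> \<in> null_sets \<mu>"
      using B ns unfolding nonsingular_def by (auto intro!: null_setsI)
    then have "AE x in \<mu>. x \<notin> T -` B \<inter> space \<mu>" by (rule AE_not_in)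
    then have "(\<integral>\<^sup>+x. ennreal (f x) * indicator (T -` B \<inter> space \<mu>) x \<partial>\<mu>) = (\<integral>\<^sup>+x. 0 \<partial>\<mu>)"
      by (intro nn_integral_cong_AE) (auto simp: indicator_def)
    then show "B \<in> null_sets N" using emN[of B] by (auto intro!: null_setsI simp: N_def)
  qed
  have setsN: "sets N = sets \<mu>" by (simp add: N_def)
  have "emeasure N (space N) < \<infinity>"
  proof -
    have "emeasure N (space \<mu>) \<le> (\<integral>\<^sup>+x. ennreal (f x) \<partial>\<mu>)"
      unfolding emN[OF sets.top] by (intro nn_integral_mono) (auto simp: indicator_def)
    also have "\<dots> < \<infinity>" using f nn by (simp add: nn_integral_eq_integral)
    finally show ?thesis by (simp add: N_def)
  qed
  then have fin: "finite_measure N" by (intro finite_measureI) auto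
  obtain D where D[measurable]: "D \<in> borel_measurable \<mu>"
    and RN: "AE x in \<mu>. RN_deriv \<mu> N x = ennreal (D x)" and D0: "\<And>x. 0 \<le> D x"
    using real_RN_deriv[OF fin ac setsN] by metis
  have "density \<mu> (\<lambda>x. ennreal (D x)) = density \<mu> (RN_deriv \<mu> N)"
  proof (intro density_cong)
    show "AE x in \<mu>. ennreal (D x) = RN_deriv \<mu> N x" using RN by eventually_elim simp
  qed auto
  also have "\<dots> = N" by (rule density_RN_deriv[OF ac setsN])
  finally have DN: "density \<mu> (\<lambda>x. ennreal (D x)) = N" .
  have eqn: "(\<integral>\<^sup>+x. ennreal (D x * indicator B x) \<partial>\<mu>) =
      (\<integral>\<^sup>+x. ennreal (f x * indicator (T -` B \<inter> space \<mu>) x) \<partial>\<mu>)" if [measurable]: "B \<in> sets \<mu>" for B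
  proof -
    have "(\<integral>\<^sup>+x. ennreal (D x) * indicator B x \<partial>\<mu>) = emeasure N B"
      unfolding DN[symmetric] by (simp add: emeasure_density)
    then show ?thesis using emN[of B] nn D0
      by (simp add: ennreal_mult' ennreal_indicator)
  qed
  have intD: "integrable \<mu> D"
  proof (rule integrableI_nonneg)
    have "(\<integral>\<^sup>+x. ennreal (D x) \<partial>\<mu>) = emeasure N (space \<mu>)"
      unfolding DN[symmetric] by (simp add: emeasure_density cong: nn_integral_cong)
    then show "(\<integral>\<^sup>+x. ennreal (D x) \<partial>\<mu>) < \<infinity>"
      using \<open>emeasure N (space N) < \<infinity>\<close> by (simp add: N_def)
  qed (use D0 in auto)
  have "(LINT x:B|\<mu>. D x) = (LINT x:(T -` B \<inter> space \<mu>)|\<mu>. f x)" if [measurable]: "B \<in> sets \<mu>" for B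
  proof -
    have "(LINT x|\<mu>. D x * indicator B x) = (LINT x|\<mu>. f x * indicator (T -` B \<inter> space \<mu>) x)"
      using eqn[of B] nn D0 by (simp add: integral_eq_nn_integral)
    then show ?thesis by (simp add: set_lebesgue_integral_def mult.commute)
  qed
  then show ?thesis using intD by blast
qed

lemma perron_frobenius_image:
  fixes f :: "'a \<Rightarrow> real"
  assumes "prob_space \<mu>" "T \<in> measurable \<mu> \<mu>" "nonsingular \<mu> T" and f: "integrable \<mu> f"
  shows "\<exists>g. integrable \<mu> g \<and>
     (\<forall>B \<in> sets \<mu>. (LINT x:B|\<mu>. g x) = (LINT x:(T -` B \<inter> space \<mu>)|\<mu>. f x))"
proof -
  let ?p = "\<lambda>x. max 0 (f x)" and ?m = "\<lambda>x. max 0 (- f x)"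
  have p: "integrable \<mu> ?p" and m: "integrable \<mu> ?m" using f by auto
  obtain g where g: "integrable \<mu> g"
    "\<And>B. B \<in> sets \<mu> \<Longrightarrow> (LINT x:B|\<mu>. g x) = (LINT x:(T -` B \<inter> space \<mu>)|\<mu>. ?p x)"
    using perron_frobenius_image_nonneg[OF assms(1-3) p] by auto
  obtain h where h: "integrable \<mu> h"
    "\<And>B. B \<in> sets \<mu> \<Longrightarrow> (LINT x:B|\<mu>. h x) = (LINT x:(T -` B \<inter> space \<mu>)|\<mu>. ?m x)"
    using perron_frobenius_image_nonneg[OF assms(1-3) m] by auto
  have si: "set_integrable \<mu> B u" if "B \<in> sets \<mu>" "integrable \<mu> u" for B and u :: "'a \<Rightarrow> real"
    using that unfolding set_integrable_def by (rule integrable_mult_indicator)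
  have "(LINT x:B|\<mu>. g x - h x) = (LINT x:(T -` B \<inter> space \<mu>)|\<mu>. f x)" if B: "B \<in> sets \<mu>" for B
  proof -
    have TB: "T -` B \<inter> space \<mu> \<in> sets \<mu>" using assms(2) B by (rule measurable_sets)
    have "(LINT x:B|\<mu>. g x - h x) =
        (LINT x:(T -` B \<inter> space \<mu>)|\<mu>. ?p x) - (LINT x:(T -` B \<inter> space \<mu>)|\<mu>. ?m x)"
      using g h si[OF B] B by (simp add: set_integral_diff)
    also have "\<dots> = (LINT x:(T -` B \<inter> space \<mu>)|\<mu>. ?p x - ?m x)"
      using si[OF TB p] si[OF TB m] by (simp add: set_integral_diff)
    also have "(\<lambda>x. ?p x - ?m x) = f" by (auto simp: max_def)
    finally show ?thesis .
  qed
  then show ?thesis using g(1) h(1) by (intro exI[of _ "\<lambda>x. g x - h x"]) auto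
qed

lemma perron_frobenius_exists:
  fixes \<mu> :: "'a measure"
  assumes "prob_space \<mu>" "T \<in> measurable \<mu> \<mu>" "nonsingular \<mu> T"
  shows "\<exists>P. perron_frobenius \<mu> T P"
proof -
  obtain P :: "('a \<Rightarrow> real) \<Rightarrow> 'a \<Rightarrow> real" where P: "\<And>f. integrable \<mu> f \<Longrightarrow> integrable \<mu> (P f)"
    "\<And>f B. integrable \<mu> f \<Longrightarrow> B \<in> sets \<mu> \<Longrightarrow>
       (LINT x:B|\<mu>. P f x) = (LINT x:(T -` B \<inter> space \<mu>)|\<mu>. f x)"
    using perron_frobenius_image[OF assms] by metis
  have si: "set_integrable \<mu> B u" if "B \<in> sets \<mu>" "integrable \<mu> u" for B and u :: "'a \<Rightarrow> real"
    using that unfolding set_integrable_def by (rule integrable_mult_indicator)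
  have TB: "T -` B \<inter> space \<mu> \<in> sets \<mu>" if "B \<in> sets \<mu>" for B
    using assms(2) that by (rule measurable_sets)
  have "AE x in \<mu>. P f x = P g x"
    if "integrable \<mu> f" "integrable \<mu> g" "AE x in \<mu>. f x = g x" for f g
  proof (rule density_unique_real)
    fix B assume B: "B \<in> sets \<mu>"
    have "(LINT x:(T -` B \<inter> space \<mu>)|\<mu>. f x) = (LINT x:(T -` B \<inter> space \<mu>)|\<mu>. g x)"
      unfolding set_lebesgue_integral_def
    proof (rule integral_cong_AE)
      show "AE x in \<mu>. indicat_real (T -` B \<inter> space \<mu>) x *\<^sub>R f x =
          indicat_real (T -` B \<inter> space \<mu>) x *\<^sub>R g x"
        using that(3) by eventually_elim simp
    qed (use that TB[OF B] in auto)
    then show "(LINT x:B|\<mu>. P f x) = (LINT x:B|\<mu>. P g x)" using P(2) that B by simp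
  qed (use P that in auto)
  moreover have "AE x in \<mu>. P (\<lambda>y. f y + g y) x = P f x + P g x"
    if "integrable \<mu> f" "integrable \<mu> g" for f g
    using that P by (intro density_unique_real) (auto simp: set_integral_add si TB)
  moreover have "AE x in \<mu>. P (\<lambda>y. c * f y) x = c * P f x" if "integrable \<mu> f" for c f
    using that P by (intro density_unique_real) (auto simp: set_integral_mult_right)
  ultimately have "L1_linear_operator \<mu> P"
    unfolding L1_linear_operator_def L1_operator_def using P(1) by simp
  then have "perron_frobenius \<mu> T P"
    unfolding perron_frobenius_def using P(2) by simp
  then show ?thesis by blast
qed

lemma Delta_repr_unique:
  assumes "prob_space \<mu>"
    and C: "\<And>i. i \<in> {1..n} \<Longrightarrow> C i n \<in> sets \<mu>" "\<And>i. i \<in> {1..n} \<Longrightarrow> 0 < measure \<mu> (C i n)"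
      "\<And>i j. i \<in> {1..n} \<Longrightarrow> j \<in> {1..n} \<Longrightarrow> i \<noteq> j \<Longrightarrow> C i n \<inter> C j n = {}"
    and ab: "AE x in \<mu>. (\<Sum>i=1..n. a i * phi \<mu> C i n x) = (\<Sum>i=1..n. b i * phi \<mu> C i n x)"
    and k: "k \<in> {1..n}"
  shows "a k = b k"
proof (rule ccontr)
  assume ne: "a k \<noteq> b k"
  interpret prob_space \<mu> by fact
  have single: "(\<Sum>i=1..n. c i * phi \<mu> C i n x) = c k / measure \<mu> (C k n)" if "x \<in> C k n" for c x
  proof -
    have "(\<Sum>i=1..n. c i * phi \<mu> C i n x) = (\<Sum>i=1..n. if i = k then c k / measure \<mu> (C k n) else 0)"
      using that C(3)[OF _ k] by (intro sum.cong) (auto simp: phi_def indicator_def)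
    then show ?thesis using k by simp
  qed
  have "AE x in \<mu>. x \<notin> C k n"
    using ab
  proof (rule AE_mp, intro AE_I2 impI notI)
    fix x assume "(\<Sum>i=1..n. a i * phi \<mu> C i n x) = (\<Sum>i=1..n. b i * phi \<mu> C i n x)" "x \<in> C k n"
    then show False using single[of x a] single[of x b] ne C(2)[OF k] by simp
  qed
  then have "measure \<mu> (C k n) = 0"
    using C(1)[OF k] by (simp add: AE_iff_null_sets[symmetric] measure_eq_0_null_sets)
  then show False using C(2)[OF k] by simp
qed

lemma Lop_linear_extension:
  assumes "prob_space \<mu>"
    and C: "\<And>i. i \<in> {1..n} \<Longrightarrow> C i n \<in> sets \<mu>" "\<And>i. i \<in> {1..n} \<Longrightarrow> 0 < measure \<mu> (C i n)"
      "\<And>i j. i \<in> {1..n} \<Longrightarrow> j \<in> {1..n} \<Longrightarrow> i \<noteq> j \<Longrightarrow> C i n \<inter> C j n = {}"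
    and g: "AE x in \<mu>. g x = (\<Sum>i=1..n. a i * phi \<mu> C i n x)"
  shows "Lop \<mu> T C \<psi> n \<epsilon> g =
    (\<lambda>x. \<Sum>i=1..n. a i * (\<Sum>j=1..n. Mmat \<mu> T C \<psi> n \<epsilon> i j * phi \<mu> C j n x))"
proof -
  let ?a = "\<lambda>i. if i \<in> {1..n} then a i else 0"
  have ga: "AE x in \<mu>. g x = (\<Sum>i=1..n. ?a i * phi \<mu> C i n x)" using g by simp
  have "Delta_coords \<mu> C n g = ?a"
    unfolding Delta_coords_def
  proof (rule the_equality)
    show "(\<forall>i. i \<notin> {1..n} \<longrightarrow> ?a i = 0) \<and> (AE x in \<mu>. g x = (\<Sum>i=1..n. ?a i * phi \<mu> C i n x))"
      using ga by simp
  next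
    fix b assume b: "(\<forall>i. i \<notin> {1..n} \<longrightarrow> b i = 0) \<and> (AE x in \<mu>. g x = (\<Sum>i=1..n. b i * phi \<mu> C i n x))"
    then have "AE x in \<mu>. g x = (\<Sum>i=1..n. b i * phi \<mu> C i n x)" by blast
    then have "AE x in \<mu>. (\<Sum>i=1..n. b i * phi \<mu> C i n x) = (\<Sum>i=1..n. ?a i * phi \<mu> C i n x)"
      using ga by eventually_elim simp
    then have "b k = ?a k" if "k \<in> {1..n}" for k
      using Delta_repr_unique[where C = C and a = b and b = ?a, OF assms(1)] C that by blast
    then show "b = ?a" using b by (auto intro!: ext)
  qed
  then show ?thesis unfolding Lop_def by (auto intro!: ext sum.cong)
qed

lemma Qop_in_Delta:
  assumes "prob_space \<mu>"
    and C: "\<And>i. i \<in> {1..n} \<Longrightarrow> C i n \<in> sets \<mu>" "\<And>i. i \<in> {1..n} \<Longrightarrow> 0 < measure \<mu> (C i n)"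
  shows "Qop \<mu> C n f \<in> Delta \<mu> C n"
proof -
  interpret prob_space \<mu> by fact
  let ?c = "\<lambda>i. L2_pairing \<mu> f (indicator (C i n)) / L2_pairing \<mu> (indicator (C i n)) (indicator (C i n))"
  have "integrable \<mu> (Qop \<mu> C n f)"
    unfolding Qop_def using C(1)
    by (intro Bochner_Integration.integrable_sum integrable_mult_right integrable_real_indicator)
       (auto simp: less_top[symmetric])
  moreover have "Qop \<mu> C n f x = (\<Sum>i=1..n. (?c i * measure \<mu> (C i n)) * phi \<mu> C i n x)" for x
    unfolding Qop_def using C(2) by (intro sum.cong) (auto simp: phi_def less_imp_neq[symmetric])
  ultimately show ?thesis
    unfolding Delta_def
    by (auto intro!: exI[of _ "\<lambda>i. ?c i * measure \<mu> (C i n)"])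
qed

end

theory Submission
  imports Defs
begin

text \<open>
  On all of $L^1$ the operator $\mathcal{T}^{(n,\varepsilon)}$ sends $f$ to
  $\sum_j (\sum_i M_{i,j} \int_{C_{i,n}} f) \phi_{j,n}$, and $M$ is a stochastic matrix, so the operator is
  Markov.  As $\varepsilon \to 0$, dominated convergence and non-singularity give
  $\mathcal{T}^{(n,\varepsilon)} f \to \mathcal{Q}^{(n)} \mathcal{T} \mathcal{Q}^{(n)} f$ in $L^1$.  Both
  $\mathcal{Q}^{(n)}$ and $\mathcal{T}$ are Markov, hence $L^1$ contractions, so the distance of this limit
  to $\mathcal{T} f$ is at most
  $\|\mathcal{Q}^{(n)} f - f\| + \|\mathcal{Q}^{(n)} \mathcal{T} f - \mathcal{T} f\|$.  That
  $\mathcal{Q}^{(n)} g \to g$ for all $g \in L^1$ is clear for Lipschitz $g$; the set of such $g$ is a closed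
  subspace, so it contains the indicators of closed sets, then by the $\pi$-$\lambda$ theorem those of
  all Borel sets, and hence every integrable function.
\<close>

section \<open>The $L^1$ norm and Markov operators\<close>

lemma L1_norm_triangle:
  assumes "integrable \<mu> f" "integrable \<mu> g"
  shows "L1_norm \<mu> (\<lambda>x. f x + g x) \<le> L1_norm \<mu> f + L1_norm \<mu> g"
proof -
  have "L1_norm \<mu> (\<lambda>x. f x + g x) \<le> (LINT x|\<mu>. \<bar>f x\<bar> + \<bar>g x\<bar>)"
    unfolding L1_norm_def using assms by (intro integral_mono) auto
  then show ?thesis using assms by (simp add: L1_norm_def)
qed

lemma L1_norm_cong_AE:
  assumes "integrable \<mu> f" "integrable \<mu> g" "AE x in \<mu>. f x = g x"
  shows "L1_norm \<mu> f = L1_norm \<mu> g"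
  unfolding L1_norm_def using assms by (intro integral_cong_AE) auto

lemma L1_norm_minus_commute: "L1_norm \<mu> (\<lambda>x. f x - g x) = L1_norm \<mu> (\<lambda>x. g x - f x)"
  by (simp add: L1_norm_def abs_minus_commute)

lemma L1_norm_nonneg: "0 \<le> L1_norm \<mu> f"
  by (simp add: L1_norm_def)

lemma L1_norm_diff_triangle:
  assumes "integrable \<mu> f" "integrable \<mu> g" "integrable \<mu> h"
  shows "L1_norm \<mu> (\<lambda>x. f x - h x) \<le> L1_norm \<mu> (\<lambda>x. f x - g x) + L1_norm \<mu> (\<lambda>x. g x - h x)"
  using L1_norm_triangle[of \<mu> "\<lambda>x. f x - g x" "\<lambda>x. g x - h x"] assms by simp

lemma L1_norm_sum_le:
  assumes "\<And>i. i \<in> I \<Longrightarrow> integrable \<mu> (f i)"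
  shows "L1_norm \<mu> (\<lambda>x. \<Sum>i\<in>I. f i x) \<le> (\<Sum>i\<in>I. L1_norm \<mu> (f i))"
proof -
  have "L1_norm \<mu> (\<lambda>x. \<Sum>i\<in>I. f i x) \<le> (LINT x|\<mu>. (\<Sum>i\<in>I. \<bar>f i x\<bar>))"
    unfolding L1_norm_def using assms by (intro integral_mono) (auto intro: sum_abs)
  also have "\<dots> = (\<Sum>i\<in>I. L1_norm \<mu> (f i))"
    unfolding L1_norm_def using assms by (intro Bochner_Integration.integral_sum) auto
  finally show ?thesis .
qed

lemma L1_linear_operator_diff:
  assumes "L1_linear_operator \<mu> P" "integrable \<mu> f" "integrable \<mu> g"
  shows "AE x in \<mu>. P (\<lambda>y. f y - g y) x = P f x - P g x"
proof -
  have "AE x in \<mu>. P (\<lambda>y. f y + - 1 * g y) x = P f x + P (\<lambda>y. - 1 * g y) x"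
    using assms integrable_mult_right[of "- 1" \<mu> g] unfolding L1_linear_operator_def by blast
  moreover have "AE x in \<mu>. P (\<lambda>y. - 1 * g y) x = - 1 * P g x"
    using assms unfolding L1_linear_operator_def by blast
  ultimately show ?thesis by eventually_elim simp
qed

lemma L1_linear_operator_integrable:
  "L1_linear_operator \<mu> P \<Longrightarrow> integrable \<mu> f \<Longrightarrow> integrable \<mu> (P f)"
  unfolding L1_linear_operator_def L1_operator_def by blast

text \<open>Positivity applied to \<open>\<bar>f\<bar> - f\<close> and
  \<open>\<bar>f\<bar> + f\<close> gives \<open>\<bar>P f\<bar> \<le> P \<bar>f\<bar>\<close> almost
  everywhere; integrating and using conservation of mass for \<open>\<bar>f\<bar>\<close> yields the
  bound.\<close>

lemma markov_operator_contraction: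
  assumes P: "markov_operator \<mu> P" and f: "integrable \<mu> f"
  shows "L1_norm \<mu> (P f) \<le> L1_norm \<mu> f"
proof -
  let ?a = "\<lambda>x. \<bar>f x\<bar>"
  have lin: "L1_linear_operator \<mu> P" using P by (simp add: markov_operator_def)
  note int = L1_linear_operator_integrable[OF lin]
  have a: "integrable \<mu> ?a" using f by simp
  have pos: "AE x in \<mu>. 0 \<le> P g x" if "integrable \<mu> g" "\<And>x. 0 \<le> g x" for g
    using P that unfolding markov_operator_def by simp
  have "AE x in \<mu>. 0 \<le> P (\<lambda>y. \<bar>f y\<bar> - f y) x" "AE x in \<mu>. 0 \<le> P (\<lambda>y. \<bar>f y\<bar> + f y) x"
    using f by (auto intro!: pos)
  moreover have "AE x in \<mu>. P (\<lambda>y. \<bar>f y\<bar> + f y) x = P ?a x + P f x"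
    using lin f a unfolding L1_linear_operator_def by blast
  moreover note L1_linear_operator_diff[OF lin a f]
  ultimately have "AE x in \<mu>. \<bar>P f x\<bar> \<le> P ?a x" by eventually_elim auto
  then have "L1_norm \<mu> (P f) \<le> (LINT x|\<mu>. P ?a x)"
    unfolding L1_norm_def using int[OF f] int[OF a] by (intro integral_mono_AE) auto
  also have "\<dots> = L1_norm \<mu> f" using P a by (simp add: markov_operator_def L1_norm_def)
  finally show ?thesis .
qed

lemma markov_operator_contraction_diff:
  assumes P: "markov_operator \<mu> P" and f: "integrable \<mu> f" and g: "integrable \<mu> g"
  shows "L1_norm \<mu> (\<lambda>x. P f x - P g x) \<le> L1_norm \<mu> (\<lambda>x. f x - g x)"
proof -
  have lin: "L1_linear_operator \<mu> P" using P by (simp add: markov_operator_def)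
  note int = L1_linear_operator_integrable[OF lin]
  have "L1_norm \<mu> (\<lambda>x. P f x - P g x) = L1_norm \<mu> (P (\<lambda>x. f x - g x))"
  proof (rule L1_norm_cong_AE)
    show "AE x in \<mu>. P f x - P g x = P (\<lambda>x. f x - g x) x"
      using L1_linear_operator_diff[OF lin f g] by eventually_elim simp
  qed (intro int f g Bochner_Integration.integrable_diff)+
  also have "\<dots> \<le> L1_norm \<mu> (\<lambda>x. f x - g x)"
    by (intro markov_operator_contraction[OF P] Bochner_Integration.integrable_diff f g)
  finally show ?thesis .
qed

text \<open>Both properties come from a choice of test set in the defining identity: the set where
  \<open>P f\<close> is negative gives positivity, the whole space gives conservation of
  mass.\<close>

lemma perron_frobenius_markov:
  assumes T: "T \<in> measurable \<mu> \<mu>" and P: "perron_frobenius \<mu> T P"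
  shows "markov_operator \<mu> P"
proof -
  have lin: "L1_linear_operator \<mu> P" using P by (simp add: perron_frobenius_def)
  note int = L1_linear_operator_integrable[OF lin]
  have set_int: "(LINT x:B|\<mu>. P f x) = (LINT x:(T -` B \<inter> space \<mu>)|\<mu>. f x)"
    if "integrable \<mu> f" "B \<in> sets \<mu>" for f B
    using P that by (simp add: perron_frobenius_def)
  have "AE x in \<mu>. 0 \<le> P f x" if f: "integrable \<mu> f" and nn: "AE x in \<mu>. 0 \<le> f x" for f
  proof -
    define B where "B = {x \<in> space \<mu>. P f x < 0}"
    have [measurable]: "P f \<in> borel_measurable \<mu>" using int[OF f] by auto
    have B[measurable]: "B \<in> sets \<mu>" unfolding B_def by measurable
    have TB: "T -` B \<inter> space \<mu> \<in> sets \<mu>" using T B by (rule measurable_sets)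
    \<comment> \<open>\<open>?h\<close> is the negative part of \<open>P f\<close>. It is
      nonnegative, while the defining identity on \<open>B\<close> makes its integral at most 0, so
      it vanishes almost everywhere.\<close>
    let ?h = "\<lambda>x. - (indicator B x * P f x)"
    have h: "integrable \<mu> ?h"
      using integrable_mult_indicator[OF B int[OF f]] by simp
    have "0 \<le> (LINT x:(T -` B \<inter> space \<mu>)|\<mu>. f x)"
      unfolding set_lebesgue_integral_def using nn
      by (intro integral_nonneg_AE) (auto elim: eventually_mono)
    then have "(LINT x|\<mu>. ?h x) \<le> 0"
      using set_int[OF f B] by (simp add: set_lebesgue_integral_def)
    moreover have h0: "AE x in \<mu>. 0 \<le> ?h x" by (auto simp: B_def indicator_def)
    ultimately have "(LINT x|\<mu>. ?h x) = 0"
      using integral_nonneg_AE[OF h0] by linarith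
    then have "AE x in \<mu>. ?h x = 0" using integral_nonneg_eq_0_iff_AE[OF h h0] by simp
    moreover have "AE x in \<mu>. x \<in> space \<mu>" by simp
    ultimately show ?thesis by eventually_elim (auto simp: B_def indicator_def split: if_splits)
  qed
  moreover have "(LINT x|\<mu>. P f x) = (LINT x|\<mu>. f x)" if "integrable \<mu> f" for f
    using set_int[OF that sets.top] measurable_space[OF T]
    by (simp add: set_integral_space int that Int_absorb1 subset_eq)
  ultimately show ?thesis using lin by (simp add: markov_operator_def)
qed


section \<open>Finite-rank operators on a partition\<close>

text \<open>A single level \<open>n\<close> is fixed. \<open>C\<close> keeps both indices so that
  \<open>phi\<close>, \<open>Qop\<close> and \<open>Mmat\<close> apply to it directly.\<close>

locale partition_space = prob_space \<mu>
  for \<mu> :: "'a measure" and C :: "nat \<Rightarrow> nat \<Rightarrow> 'a set" and n :: nat +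
  assumes C_sets: "i \<in> {1..n} \<Longrightarrow> C i n \<in> sets \<mu>"
    and C_disjoint: "i \<in> {1..n} \<Longrightarrow> j \<in> {1..n} \<Longrightarrow> i \<noteq> j \<Longrightarrow> C i n \<inter> C j n = {}"
    and C_cover: "(\<Union>i\<in>{1..n}. C i n) = space \<mu>"
    and C_pos: "i \<in> {1..n} \<Longrightarrow> 0 < measure \<mu> (C i n)"
begin

lemma cell_set_integrable:
  fixes f :: "'a \<Rightarrow> real"
  shows "integrable \<mu> f \<Longrightarrow> i \<in> {1..n} \<Longrightarrow> set_integrable \<mu> (C i n) f"
  unfolding set_integrable_def by (intro integrable_mult_indicator C_sets)

lemma sum_cell_integrals:
  fixes f :: "'a \<Rightarrow> real"
  assumes "integrable \<mu> f"
  shows "(\<Sum>i=1..n. LINT x:C i n|\<mu>. f x) = (LINT x|\<mu>. f x)"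
proof -
  have "(LINT x:(\<Union>i\<in>{1..n}. C i n)|\<mu>. f x) = (\<Sum>i=1..n. LINT x:C i n|\<mu>. f x)"
    using assms cell_set_integrable C_sets C_disjoint
    by (intro set_integral_finite_Union) (auto simp: disjoint_family_on_def)
  then show ?thesis using assms by (simp only: C_cover set_integral_space)
qed

lemma integrable_phi: "i \<in> {1..n} \<Longrightarrow> integrable \<mu> (phi \<mu> C i n)"
  unfolding phi_def using C_sets by (auto simp: less_top[symmetric])

lemma integral_phi: "i \<in> {1..n} \<Longrightarrow> (LINT x|\<mu>. phi \<mu> C i n x) = 1"
  unfolding phi_def using C_sets[of i] C_pos[of i] by (auto simp: sets.Int_space_eq2)

lemma phi_nonneg: "0 \<le> phi \<mu> C i n x"
  by (simp add: phi_def)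

lemma L1_norm_phi: "i \<in> {1..n} \<Longrightarrow> L1_norm \<mu> (\<lambda>x. c * phi \<mu> C i n x) = \<bar>c\<bar>"
  by (simp add: L1_norm_def abs_mult phi_nonneg integral_phi)

text \<open>The row vector of cell integrals of \<open>f\<close> is multiplied by \<open>m\<close>,
  and the result is read as coefficients of the densities \<open>phi\<close>. This form covers both
  operators of interest, with the identity matrix for \<open>Qop\<close> and \<open>Mmat\<close> for
  \<open>reg_approx\<close>, and it avoids the definite description in
  \<open>Delta_coords\<close>.\<close>

definition matrix_op :: "(nat \<Rightarrow> nat \<Rightarrow> real) \<Rightarrow> ('a \<Rightarrow> real) \<Rightarrow> 'a \<Rightarrow> real" where
  "matrix_op m f = (\<lambda>x. \<Sum>j=1..n. (\<Sum>i=1..n. (LINT y:C i n|\<mu>. f y) * m i j) * phi \<mu> C j n x)"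

lemma integrable_matrix_op: "integrable \<mu> (matrix_op m f)"
  unfolding matrix_op_def using integrable_phi by (intro Bochner_Integration.integrable_sum) auto

lemma integral_matrix_op:
  "(LINT x|\<mu>. matrix_op m f x) = (\<Sum>j=1..n. \<Sum>i=1..n. (LINT y:C i n|\<mu>. f y) * m i j)"
  unfolding matrix_op_def
  by (subst Bochner_Integration.integral_sum) (auto simp: integrable_phi integral_phi)

text \<open>A row-stochastic matrix maps nonnegative cell masses to nonnegative coefficients. Each
  \<open>phi\<close> has integral 1, so the mass of the image is the sum of its coefficients;
  exchanging the sums leaves each cell integral multiplied by a row sum.\<close>

lemma markov_matrix_op:
  assumes nn: "\<And>i j. i \<in> {1..n} \<Longrightarrow> j \<in> {1..n} \<Longrightarrow> 0 \<le> m i j"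
    and row: "\<And>i. i \<in> {1..n} \<Longrightarrow> (\<Sum>j=1..n. m i j) = 1"
  shows "markov_operator \<mu> (matrix_op m)"
proof -
  \<comment> \<open>The operator sees \<open>f\<close> only through its cell integrals, so functions
    equal almost everywhere have images equal at every point. The other properties also hold
    pointwise, which is why \<open>AE_I2\<close> suffices at the end.\<close>
  have cong: "matrix_op m f x = matrix_op m g x"
    if "integrable \<mu> f" "integrable \<mu> g" "AE x in \<mu>. f x = g x" for f g x
  proof -
    have "(LINT y:C i n|\<mu>. f y) = (LINT y:C i n|\<mu>. g y)" if "i \<in> {1..n}" for i
      using \<open>AE x in \<mu>. f x = g x\<close> \<open>integrable \<mu> f\<close> \<open>integrable \<mu> g\<close> C_sets[OF that]
      unfolding set_lebesgue_integral_def
      by (intro integral_cong_AE) (auto elim: eventually_mono)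
    then show ?thesis by (simp add: matrix_op_def)
  qed
  have add: "matrix_op m (\<lambda>y. f y + g y) x = matrix_op m f x + matrix_op m g x"
    if "integrable \<mu> f" "integrable \<mu> g" for f g x
  proof -
    have "(LINT y:C i n|\<mu>. f y + g y) = (LINT y:C i n|\<mu>. f y) + (LINT y:C i n|\<mu>. g y)"
      if "i \<in> {1..n}" for i
      using \<open>integrable \<mu> f\<close> \<open>integrable \<mu> g\<close> cell_set_integrable that by (intro set_integral_add) auto
    then show ?thesis by (simp add: matrix_op_def distrib_right sum.distrib)
  qed
  have scale: "matrix_op m (\<lambda>y. c * f y) x = c * matrix_op m f x" for c f x
    by (simp add: matrix_op_def sum_distrib_left sum_distrib_right mult.assoc)
  have pos: "0 \<le> matrix_op m f x" if "integrable \<mu> f" "AE x in \<mu>. 0 \<le> f x" for f x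
  proof -
    have "0 \<le> (LINT y:C i n|\<mu>. f y)" for i
      unfolding set_lebesgue_integral_def using that
      by (intro integral_nonneg_AE) (auto elim: eventually_mono)
    then show ?thesis unfolding matrix_op_def
      by (intro sum_nonneg mult_nonneg_nonneg phi_nonneg nn) auto
  qed
  have mass: "(LINT x|\<mu>. matrix_op m f x) = (LINT x|\<mu>. f x)" if "integrable \<mu> f" for f
  proof -
    have "(LINT x|\<mu>. matrix_op m f x) = (\<Sum>i=1..n. (LINT y:C i n|\<mu>. f y) * (\<Sum>j=1..n. m i j))"
      unfolding integral_matrix_op sum_distrib_left by (rule sum.swap)
    then show ?thesis using sum_cell_integrals[OF that] by (simp add: row del: One_nat_def)
  qed
  show ?thesis
    unfolding markov_operator_def L1_linear_operator_def L1_operator_def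
    by (intro conjI allI impI AE_I2 integrable_matrix_op)
       (erule (2) cong, erule (1) add, rule scale, erule (1) pos, erule mass)
qed

text \<open>Every \<open>phi\<close> has norm 1, so the triangle inequality bounds the distance of
  two images by the l1 distance of their coefficient vectors. Norm convergence thereby reduces to
  convergence of finitely many numbers.\<close>

lemma L1_norm_matrix_op_diff:
  "L1_norm \<mu> (\<lambda>x. matrix_op m f x - matrix_op m' g x) \<le>
    (\<Sum>j=1..n. \<bar>(\<Sum>i=1..n. (LINT y:C i n|\<mu>. f y) * m i j) - (\<Sum>i=1..n. (LINT y:C i n|\<mu>. g y) * m' i j)\<bar>)"
proof -
  let ?d = "\<lambda>j. (\<Sum>i=1..n. (LINT y:C i n|\<mu>. f y) * m i j) - (\<Sum>i=1..n. (LINT y:C i n|\<mu>. g y) * m' i j)"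
  have "L1_norm \<mu> (\<lambda>x. matrix_op m f x - matrix_op m' g x) =
      L1_norm \<mu> (\<lambda>x. \<Sum>j=1..n. ?d j * phi \<mu> C j n x)"
    by (simp add: matrix_op_def sum_subtractf left_diff_distrib)
  also have "\<dots> \<le> (\<Sum>j=1..n. L1_norm \<mu> (\<lambda>x. ?d j * phi \<mu> C j n x))"
    using integrable_phi by (intro L1_norm_sum_le) auto
  finally show ?thesis by (simp add: L1_norm_phi)
qed

section \<open>The averaging operator and the regularised approximation as finite-rank
  operators\<close>

lemma L2_pairing_indicator: "L2_pairing \<mu> f (indicator A) = (LINT x:A|\<mu>. f x)"
  for f :: "'a \<Rightarrow> real"
  by (simp add: L2_pairing_def set_lebesgue_integral_def mult.commute)

lemma L2_pairing_cell:
  "i \<in> {1..n} \<Longrightarrow> L2_pairing \<mu> (indicator (C i n)) (indicator (C i n)) = measure \<mu> (C i n)"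
  using C_sets[of i]
  by (simp add: L2_pairing_def indicator_inter_arith[symmetric] sets.Int_space_eq2)

lemma Qop_expansion: "Qop \<mu> C n f x = (\<Sum>i=1..n. (LINT y:C i n|\<mu>. f y) * phi \<mu> C i n x)"
  unfolding Qop_def phi_def
  \<comment> \<open>The normalising denominators are rewritten first, because
    \<open>L2_pairing_indicator\<close> also matches them.\<close>
  by (intro sum.cong) (simp_all add: L2_pairing_cell, simp add: L2_pairing_indicator)

lemma Qop_eq_matrix_op: "Qop \<mu> C n = matrix_op (\<lambda>i j. of_bool (i = j))"
  by (intro ext) (simp add: Qop_expansion matrix_op_def of_bool_def if_distrib[of "(*) _"] cong: if_cong)

lemma markov_Qop: "markov_operator \<mu> (Qop \<mu> C n)"
  unfolding Qop_eq_matrix_op by (rule markov_matrix_op) auto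

lemma Qop_on_cell:
  assumes i: "i \<in> {1..n}" and x: "x \<in> C i n"
  shows "Qop \<mu> C n f x = (LINT y:C i n|\<mu>. f y) / measure \<mu> (C i n)"
proof -
  have "(LINT y:C j n|\<mu>. f y) * phi \<mu> C j n x =
      (if j = i then (LINT y:C i n|\<mu>. f y) / measure \<mu> (C i n) else 0)" if "j \<in> {1..n}" for j
    using C_disjoint[OF that i] x by (auto simp: phi_def indicator_def)
  then have "Qop \<mu> C n f x = (\<Sum>j=1..n. if j = i then (LINT y:C i n|\<mu>. f y) / measure \<mu> (C i n) else 0)"
    unfolding Qop_expansion by (intro sum.cong) auto
  then show ?thesis using i by simp
qed

text \<open>At a point of a cell, \<open>Qop\<close> is the mean of \<open>g\<close> over that cell,
  which differs from the value of \<open>g\<close> there by at most the oscillation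
  \<open>e\<close>. Total mass 1 turns this uniform bound into an L1 bound.\<close>

lemma Qop_close:
  assumes g: "integrable \<mu> g"
    and osc: "\<And>i x y. i \<in> {1..n} \<Longrightarrow> x \<in> C i n \<Longrightarrow> y \<in> C i n \<Longrightarrow> \<bar>g x - g y\<bar> \<le> e"
  shows "L1_norm \<mu> (\<lambda>x. Qop \<mu> C n g x - g x) \<le> e"
proof -
  have "\<bar>Qop \<mu> C n g x - g x\<bar> \<le> e" if "x \<in> space \<mu>" for x
  proof -
    obtain i where i: "i \<in> {1..n}" "x \<in> C i n" using \<open>x \<in> space \<mu>\<close> C_cover by blast
    let ?m = "measure \<mu> (C i n)"
    have const: "(LINT y:C i n|\<mu>. c) = c * ?m" "set_integrable \<mu> (C i n) (\<lambda>y. c)" for c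
      using C_sets[OF i(1)]
      by (auto simp: set_lebesgue_integral_def sets.Int_space_eq2 intro!: cell_set_integrable i(1))
    have gi: "set_integrable \<mu> (C i n) g" by (rule cell_set_integrable[OF g i(1)])
    have "(LINT y:C i n|\<mu>. g y) \<le> (LINT y:C i n|\<mu>. g x + e)"
      using osc[OF i(1) i(2)] by (intro set_integral_mono gi const(2)) (fastforce simp: abs_le_iff)
    moreover have "(LINT y:C i n|\<mu>. g x - e) \<le> (LINT y:C i n|\<mu>. g y)"
      using osc[OF i(1) i(2)] by (intro set_integral_mono gi const(2)) (fastforce simp: abs_le_iff)
    ultimately have "g x - e \<le> Qop \<mu> C n g x" "Qop \<mu> C n g x \<le> g x + e"
      using C_pos[OF i(1)] by (simp_all add: Qop_on_cell[OF i] const divide_simps)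
    then show ?thesis by (simp add: abs_le_iff)
  qed
  moreover have "integrable \<mu> (Qop \<mu> C n g)" by (simp add: Qop_eq_matrix_op integrable_matrix_op)
  ultimately have "L1_norm \<mu> (\<lambda>x. Qop \<mu> C n g x - g x) \<le> (LINT x|\<mu>. e)"
    unfolding L1_norm_def using g by (intro integral_mono) auto
  then show ?thesis by (simp add: prob_space)
qed

text \<open>The coordinates of \<open>Qop \<mu> C n f\<close> in the basis \<open>phi\<close> are
  the cell integrals of \<open>f\<close>, so \<open>Lop_linear_extension\<close> evaluates
  \<open>Lop\<close> on it; exchanging the two sums gives the matrix form.\<close>

lemma reg_approx_eq_matrix_op: "reg_approx \<mu> T C \<psi> n \<epsilon> = matrix_op (Mmat \<mu> T C \<psi> n \<epsilon>)"
proof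
  fix f
  have "Lop \<mu> T C \<psi> n \<epsilon> (Qop \<mu> C n f) = (\<lambda>x. \<Sum>i=1..n. (LINT y:C i n|\<mu>. f y) *
      (\<Sum>j=1..n. Mmat \<mu> T C \<psi> n \<epsilon> i j * phi \<mu> C j n x))"
    by (rule Lop_linear_extension) (auto simp: Qop_expansion C_sets C_pos C_disjoint prob_space_axioms)
  also have "\<dots> = matrix_op (Mmat \<mu> T C \<psi> n \<epsilon>) f"
    unfolding matrix_op_def sum_distrib_left sum_distrib_right
    by (subst sum.swap) (simp add: mult.assoc)
  finally show "reg_approx \<mu> T C \<psi> n \<epsilon> f = matrix_op (Mmat \<mu> T C \<psi> n \<epsilon>) f"
    by (simp add: reg_approx_def)
qed

lemma Mmat_eq: "i \<in> {1..n} \<Longrightarrow>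
    Mmat \<mu> T C \<psi> n \<epsilon> i j = (LINT x:C i n|\<mu>. \<psi> \<epsilon> j n (T x)) / measure \<mu> (C i n)"
  unfolding Mmat_def L2_pairing_cell by (simp add: L2_pairing_indicator)

lemma integrable_Qop: "integrable \<mu> (Qop \<mu> C n f)"
  by (simp add: Qop_eq_matrix_op integrable_matrix_op)

text \<open>Meant for \<open>A\<close> the preimage of a cell under \<open>T\<close>. The last
  factor is the fraction of the cell lying in \<open>A\<close>, kept as an integral so that it
  coincides with the limit in \<open>Mmat_tendsto\<close>.\<close>

lemma set_integral_Qop:
  assumes A: "A \<in> sets \<mu>"
  shows "(LINT x:A|\<mu>. Qop \<mu> C n f x) =
    (\<Sum>i=1..n. (LINT y:C i n|\<mu>. f y) * ((LINT x:C i n|\<mu>. indicator A x) / measure \<mu> (C i n)))"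
proof -
  have phi: "integrable \<mu> (\<lambda>x. indicator A x * phi \<mu> C i n x)" if "i \<in> {1..n}" for i
    using integrable_mult_indicator[OF A integrable_phi[OF that]] by simp
  have "(LINT x:A|\<mu>. Qop \<mu> C n f x) =
      (LINT x|\<mu>. (\<Sum>i=1..n. (LINT y:C i n|\<mu>. f y) * (indicator A x * phi \<mu> C i n x)))"
    unfolding set_lebesgue_integral_def Qop_expansion
    by (simp add: sum_distrib_left mult.left_commute)
  also have "\<dots> = (\<Sum>i=1..n. (LINT y:C i n|\<mu>. f y) * (LINT x|\<mu>. indicator A x * phi \<mu> C i n x))"
    using phi by (subst Bochner_Integration.integral_sum) auto
  also have "\<dots> = (\<Sum>i=1..n. (LINT y:C i n|\<mu>. f y) *
      ((LINT x:C i n|\<mu>. indicator A x) / measure \<mu> (C i n)))"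
    by (simp add: phi_def set_lebesgue_integral_def mult.commute)
  finally show ?thesis .
qed

end

section \<open>The Markov property for fixed \<open>\<epsilon>\<close>, and the limit as
  \<open>\<epsilon>\<close> tends to 0\<close>

lemma nonsingular_AE:
  assumes T: "T \<in> measurable \<mu> \<mu>" and ns: "nonsingular \<mu> T" and Q: "AE x in \<mu>. Q x"
  shows "AE x in \<mu>. Q (T x)"
proof -
  obtain N where N: "{x \<in> space \<mu>. \<not> Q x} \<subseteq> N" "emeasure \<mu> N = 0" "N \<in> sets \<mu>"
    using Q by (rule AE_E)
  show ?thesis
  proof (rule AE_I)
    show "{x \<in> space \<mu>. \<not> Q (T x)} \<subseteq> T -` N \<inter> space \<mu>"
      using N(1) measurable_space[OF T] by auto
    show "emeasure \<mu> (T -` N \<inter> space \<mu>) = 0" using ns N by (simp add: nonsingular_def)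
    show "T -` N \<inter> space \<mu> \<in> sets \<mu>" using T N(3) by (rule measurable_sets)
  qed
qed

locale regularized_partition = partition_space \<mu> C n
  for \<mu> :: "'a measure" and C :: "nat \<Rightarrow> nat \<Rightarrow> 'a set" and n :: nat +
  fixes T :: "'a \<Rightarrow> 'a" and \<psi> :: "real \<Rightarrow> nat \<Rightarrow> nat \<Rightarrow> 'a \<Rightarrow> real"
  assumes T_measurable[measurable]: "T \<in> measurable \<mu> \<mu>"
    and psi_integrable: "0 < \<epsilon> \<Longrightarrow> i \<in> {1..n} \<Longrightarrow> integrable \<mu> (\<psi> \<epsilon> i n)"
    and psi_nonneg: "0 < \<epsilon> \<Longrightarrow> i \<in> {1..n} \<Longrightarrow> 0 \<le> \<psi> \<epsilon> i n x"
    and psi_sum: "0 < \<epsilon> \<Longrightarrow> (\<Sum>i=1..n. \<psi> \<epsilon> i n x) = 1"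
begin

text \<open>One term of a sum of nonnegative terms with value 1. The bound is uniform in
  \<open>\<epsilon>\<close> and serves as the dominating constant below.\<close>

lemma psi_le_1: "0 < \<epsilon> \<Longrightarrow> i \<in> {1..n} \<Longrightarrow> \<psi> \<epsilon> i n x \<le> 1"
  using member_le_sum[of i "{1..n}" "\<lambda>i. \<psi> \<epsilon> i n x"] psi_nonneg[of \<epsilon> _ x]
  by (simp add: psi_sum del: One_nat_def)

lemma psi_T_measurable: "0 < \<epsilon> \<Longrightarrow> i \<in> {1..n} \<Longrightarrow> (\<lambda>x. \<psi> \<epsilon> i n (T x)) \<in> borel_measurable \<mu>"
  by (intro measurable_compose[OF T_measurable] borel_measurable_integrable psi_integrable)

text \<open>\<open>T\<close> need not preserve \<open>\<mu>\<close>, so integrability does not carry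
  over to the composition; boundedness by 1 on a probability space provides it.\<close>

lemma psi_T_integrable:
  assumes "0 < \<epsilon>" "i \<in> {1..n}"
  shows "integrable \<mu> (\<lambda>x. \<psi> \<epsilon> i n (T x))"
proof (rule integrable_const_bound[where B = 1])
  show "AE x in \<mu>. norm (\<psi> \<epsilon> i n (T x)) \<le> 1"
    using psi_nonneg[OF assms] psi_le_1[OF assms] by simp
qed (rule psi_T_measurable[OF assms])

text \<open>The functions \<open>\<psi>\<close> sum to 1 at every point, hence also after
  composition with \<open>T\<close>; integrating over a cell and dividing by its measure gives row
  sums 1.\<close>

lemma markov_reg_approx:
  assumes e: "0 < \<epsilon>"
  shows "markov_operator \<mu> (reg_approx \<mu> T C \<psi> n \<epsilon>)"
  unfolding reg_approx_eq_matrix_op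
proof (rule markov_matrix_op)
  fix i j assume i: "i \<in> {1..n}" and j: "j \<in> {1..n}"
  have "0 \<le> (LINT x:C i n|\<mu>. \<psi> \<epsilon> j n (T x))"
    unfolding set_lebesgue_integral_def using psi_nonneg[OF e j] by (intro integral_nonneg_AE) auto
  then show "0 \<le> Mmat \<mu> T C \<psi> n \<epsilon> i j" by (simp add: Mmat_eq[OF i])
next
  fix i assume i: "i \<in> {1..n}"
  have "(\<Sum>j=1..n. LINT x:C i n|\<mu>. \<psi> \<epsilon> j n (T x)) = (LINT x:C i n|\<mu>. (\<Sum>j=1..n. \<psi> \<epsilon> j n (T x)))"
    unfolding set_lebesgue_integral_def scaleR_sum_right
    by (intro Bochner_Integration.integral_sum[symmetric] integrable_mult_indicator
        C_sets[OF i] psi_T_integrable[OF e])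
  also have "\<dots> = measure \<mu> (C i n)"
    using C_sets[OF i] by (simp only: psi_sum[OF e]) (simp add: set_lebesgue_integral_def sets.Int_space_eq2)
  finally show "(\<Sum>j=1..n. Mmat \<mu> T C \<psi> n \<epsilon> i j) = 1"
    using C_pos[OF i] by (simp add: Mmat_eq[OF i] sum_divide_distrib[symmetric])
qed

text \<open>Nonsingularity transfers the almost everywhere convergence of \<open>\<psi>\<close> from
  \<open>x\<close> to \<open>T x\<close>; dominated convergence with bound 1 then moves the limit
  inside the integral.\<close>

lemma Mmat_tendsto:
  assumes ns: "nonsingular \<mu> T" and i: "i \<in> {1..n}" and j: "j \<in> {1..n}"
    and lim: "AE x in \<mu>. ((\<lambda>\<epsilon>. \<psi> \<epsilon> j n x) \<longlongrightarrow> indicator (C j n) x) (at_right 0)"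
  shows "((\<lambda>\<epsilon>. Mmat \<mu> T C \<psi> n \<epsilon> i j) \<longlongrightarrow>
    (LINT x:C i n|\<mu>. indicator (T -` C j n \<inter> space \<mu>) x) / measure \<mu> (C i n)) (at_right 0)"
proof -
  let ?A = "T -` C j n \<inter> space \<mu>"
  have A: "?A \<in> sets \<mu>" using T_measurable C_sets[OF j] by (rule measurable_sets)
  have "((\<lambda>\<epsilon>. LINT x:C i n|\<mu>. \<psi> \<epsilon> j n (T x)) \<longlongrightarrow> (LINT x:C i n|\<mu>. indicator ?A x)) (at_right 0)"
  \<comment> \<open>Dominated convergence is applied along sequences, so the one-sided limit is
    tested on sequences \<open>S\<close> of positive reals tending to 0.\<close>
  proof (rule tendsto_at_right_sequentially[OF zero_less_one])
    fix S :: "nat \<Rightarrow> real" assume S: "\<And>k. 0 < S k" "S \<longlonglongrightarrow> 0"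
    have S': "filterlim S (at_right 0) sequentially"
      by (intro tendsto_imp_filterlim_at_right S(2) always_eventually allI S(1))
    show "(\<lambda>k. LINT x:C i n|\<mu>. \<psi> (S k) j n (T x)) \<longlonglongrightarrow> (LINT x:C i n|\<mu>. indicator ?A x)"
      unfolding set_lebesgue_integral_def
    proof (rule integral_dominated_convergence[where w = "\<lambda>_. 1"])
      show "(\<lambda>x. indicat_real (C i n) x *\<^sub>R indicat_real ?A x) \<in> borel_measurable \<mu>"
        using A C_sets[OF i] by measurable
      show "(\<lambda>x. indicat_real (C i n) x *\<^sub>R \<psi> (S k) j n (T x)) \<in> borel_measurable \<mu>" for k
        using C_sets[OF i] psi_T_measurable[OF S(1)[of k] j] by measurable
      show "AE x in \<mu>. norm (indicat_real (C i n) x *\<^sub>R \<psi> (S k) j n (T x)) \<le> 1" for k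
        using psi_nonneg[OF S(1)[of k] j] psi_le_1[OF S(1)[of k] j]
        by (auto simp: indicator_def)
      have "AE x in \<mu>. x \<in> space \<mu>" by simp
      then show "AE x in \<mu>. (\<lambda>k. indicat_real (C i n) x *\<^sub>R \<psi> (S k) j n (T x))
          \<longlonglongrightarrow> indicat_real (C i n) x *\<^sub>R indicat_real ?A x"
        using nonsingular_AE[OF T_measurable ns lim]
      proof eventually_elim
        case (elim x)
        then have "(\<lambda>k. \<psi> (S k) j n (T x)) \<longlonglongrightarrow> indicat_real ?A x"
          using filterlim_compose[OF elim(2) S'] by (simp add: indicator_def)
        then show ?case by (intro tendsto_intros)
      qed
    qed simp
  qed
  then show ?thesis
    unfolding Mmat_eq[OF i] using C_pos[OF i] by (intro tendsto_divide tendsto_const) auto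
qed

text \<open>The limit of the coefficient at cell \<open>j\<close> is the integral of
  \<open>Qop \<mu> C n f\<close> over the preimage of that cell. By the Perron-Frobenius identity
  this is the integral of \<open>P (Qop \<mu> C n f)\<close> over the cell itself, that is, the
  coefficient of its average.\<close>

lemma reg_approx_tendsto:
  assumes ns: "nonsingular \<mu> T" and P: "perron_frobenius \<mu> T P" and f: "integrable \<mu> f"
    and lim: "\<And>j. j \<in> {1..n} \<Longrightarrow>
      (AE x in \<mu>. ((\<lambda>\<epsilon>. \<psi> \<epsilon> j n x) \<longlongrightarrow> indicator (C j n) x) (at_right 0))"
  shows "((\<lambda>\<epsilon>. L1_norm \<mu> (\<lambda>x. reg_approx \<mu> T C \<psi> n \<epsilon> f x - Qop \<mu> C n (P (Qop \<mu> C n f)) x))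
    \<longlongrightarrow> 0) (at_right 0)"
proof -
  let ?c = "\<lambda>\<epsilon> j. \<Sum>i=1..n. (LINT y:C i n|\<mu>. f y) * Mmat \<mu> T C \<psi> n \<epsilon> i j"
  let ?g = "P (Qop \<mu> C n f)"
  have "((\<lambda>\<epsilon>. ?c \<epsilon> j) \<longlongrightarrow> (LINT y:C j n|\<mu>. ?g y)) (at_right 0)" if j: "j \<in> {1..n}" for j
  proof -
    have "(LINT y:C j n|\<mu>. ?g y) = (LINT y:(T -` C j n \<inter> space \<mu>)|\<mu>. Qop \<mu> C n f y)"
      using P integrable_Qop C_sets[OF j] by (simp add: perron_frobenius_def)
    also have "\<dots> = (\<Sum>i=1..n. (LINT y:C i n|\<mu>. f y) *
        ((LINT x:C i n|\<mu>. indicator (T -` C j n \<inter> space \<mu>) x) / measure \<mu> (C i n)))"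
      by (intro set_integral_Qop measurable_sets[OF T_measurable C_sets[OF j]])
    finally show ?thesis
      by (simp only:) (intro tendsto_sum tendsto_mult tendsto_const Mmat_tendsto ns j lim)
  qed
  then have "((\<lambda>\<epsilon>. \<Sum>j=1..n. \<bar>?c \<epsilon> j - (LINT y:C j n|\<mu>. ?g y)\<bar>) \<longlongrightarrow>
      (\<Sum>j=1..n. \<bar>(LINT y:C j n|\<mu>. ?g y) - (LINT y:C j n|\<mu>. ?g y)\<bar>)) (at_right 0)"
    by (intro tendsto_sum tendsto_rabs tendsto_diff tendsto_const) auto
  then have "((\<lambda>\<epsilon>. \<Sum>j=1..n. \<bar>?c \<epsilon> j - (LINT y:C j n|\<mu>. ?g y)\<bar>) \<longlongrightarrow> 0) (at_right 0)" by simp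
  then show ?thesis
  proof (rule tendsto_sandwich[rotated 2, OF tendsto_const])
    \<comment> \<open>With the averaged limit viewed as a \<open>matrix_op\<close> for the identity
      matrix, \<open>L1_norm_matrix_op_diff\<close> applies to both terms of the difference; this
      identity simplifies the second coefficient.\<close>
    have "(\<Sum>i=1..n. (LINT y:C i n|\<mu>. ?g y) * of_bool (i = j)) = (LINT y:C j n|\<mu>. ?g y)"
      if "j \<in> {1..n}" for j
      using that by (simp add: of_bool_def if_distrib[of "(*) _"] cong: if_cong)
    then show "\<forall>\<^sub>F \<epsilon> in at_right 0.
        L1_norm \<mu> (\<lambda>x. reg_approx \<mu> T C \<psi> n \<epsilon> f x - Qop \<mu> C n ?g x) \<le>
        (\<Sum>j=1..n. \<bar>?c \<epsilon> j - (LINT y:C j n|\<mu>. ?g y)\<bar>)"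
      using L1_norm_matrix_op_diff[of _ f "\<lambda>i j. of_bool (i = j)" ?g]
      by (intro always_eventually allI) (simp add: reg_approx_eq_matrix_op Qop_eq_matrix_op del: One_nat_def)
  qed (intro always_eventually allI L1_norm_nonneg)
qed

end


section \<open>Strong convergence of the averaging operators\<close>

text \<open>The common form of the three approximations used below: indicators of closed sets by
  Lipschitz functions, of countable unions by finite ones, and integrable functions by an
  approximating sequence.\<close>

lemma L1_norm_tendsto_dominated:
  assumes "integrable \<mu> g" "\<And>i. integrable \<mu> (s i)" and w: "integrable \<mu> w"
    and lim: "\<And>x. x \<in> space \<mu> \<Longrightarrow> (\<lambda>i. s i x) \<longlonglongrightarrow> g x"
    and bound: "\<And>i x. x \<in> space \<mu> \<Longrightarrow> \<bar>g x - s i x\<bar> \<le> w x"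
  shows "(\<lambda>i. L1_norm \<mu> (\<lambda>x. g x - s i x)) \<longlonglongrightarrow> 0"
proof -
  have "(\<lambda>i. LINT x|\<mu>. \<bar>g x - s i x\<bar>) \<longlonglongrightarrow> (LINT x|\<mu>. 0)"
  proof (rule integral_dominated_convergence[OF _ _ w])
    show "AE x in \<mu>. (\<lambda>i. \<bar>g x - s i x\<bar>) \<longlonglongrightarrow> 0"
    proof (rule AE_I2)
      fix x assume "x \<in> space \<mu>"
      from tendsto_rabs[OF tendsto_diff[OF tendsto_const[of "g x"] lim[OF this]]]
      show "(\<lambda>i. \<bar>g x - s i x\<bar>) \<longlonglongrightarrow> 0" by simp
    qed
  qed (use assms in auto)
  then show ?thesis by (simp add: L1_norm_def)
qed

text \<open>The functions on which the operators converge to the identity form a closed subspace for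
  any sequence of Markov operators, so partitions do not appear here. Indexing starts at 1 because
  zero cells cannot cover the space.\<close>

locale markov_sequence =
  fixes \<mu> :: "'a measure" and Q :: "nat \<Rightarrow> ('a \<Rightarrow> real) \<Rightarrow> 'a \<Rightarrow> real"
  assumes markov: "1 \<le> n \<Longrightarrow> markov_operator \<mu> (Q n)"
begin

definition convergent_at :: "('a \<Rightarrow> real) \<Rightarrow> bool" where
  "convergent_at g \<longleftrightarrow> (\<lambda>n. L1_norm \<mu> (\<lambda>x. Q n g x - g x)) \<longlonglongrightarrow> 0"

lemma linear: "1 \<le> n \<Longrightarrow> L1_linear_operator \<mu> (Q n)"
  using markov by (simp add: markov_operator_def)

lemma integrable_Q: "1 \<le> n \<Longrightarrow> integrable \<mu> g \<Longrightarrow> integrable \<mu> (Q n g)"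
  using linear by (rule L1_linear_operator_integrable)

lemma convergent_at_le:
  assumes "e \<longlonglongrightarrow> 0" "\<And>n. 1 \<le> n \<Longrightarrow> L1_norm \<mu> (\<lambda>x. Q n g x - g x) \<le> e n"
  shows "convergent_at g"
  unfolding convergent_at_def
proof (rule tendsto_sandwich[OF _ _ tendsto_const assms(1)])
  show "\<forall>\<^sub>F n in sequentially. L1_norm \<mu> (\<lambda>x. Q n g x - g x) \<le> e n"
    using eventually_ge_at_top[of 1] by eventually_elim (rule assms(2))
qed (intro always_eventually allI L1_norm_nonneg)

lemma convergent_at_add:
  assumes f: "integrable \<mu> f" "convergent_at f" and g: "integrable \<mu> g" "convergent_at g"
  shows "convergent_at (\<lambda>x. f x + g x)"
proof (rule convergent_at_le)
  show "(\<lambda>n. L1_norm \<mu> (\<lambda>x. Q n f x - f x) + L1_norm \<mu> (\<lambda>x. Q n g x - g x)) \<longlonglongrightarrow> 0"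
    using tendsto_add[OF f(2)[unfolded convergent_at_def] g(2)[unfolded convergent_at_def]] by simp
  fix n :: nat assume n: "1 \<le> n"
  note int = f(1) g(1) integrable_Q[OF n f(1)] integrable_Q[OF n g(1)]
    integrable_Q[OF n Bochner_Integration.integrable_add[OF f(1) g(1)]]
  have "AE x in \<mu>. Q n (\<lambda>x. f x + g x) x = Q n f x + Q n g x"
    using linear[OF n] f(1) g(1) unfolding L1_linear_operator_def by blast
  then have "AE x in \<mu>. Q n (\<lambda>x. f x + g x) x - (f x + g x) = (Q n f x - f x) + (Q n g x - g x)"
    by eventually_elim simp
  then have "L1_norm \<mu> (\<lambda>x. Q n (\<lambda>x. f x + g x) x - (f x + g x)) =
      L1_norm \<mu> (\<lambda>x. (Q n f x - f x) + (Q n g x - g x))"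
    using int by (intro L1_norm_cong_AE) auto
  also have "\<dots> \<le> L1_norm \<mu> (\<lambda>x. Q n f x - f x) + L1_norm \<mu> (\<lambda>x. Q n g x - g x)"
    using int by (intro L1_norm_triangle) auto
  finally show "L1_norm \<mu> (\<lambda>x. Q n (\<lambda>x. f x + g x) x - (f x + g x)) \<le> \<dots>" .
qed

lemma convergent_at_scale:
  assumes f: "integrable \<mu> f" "convergent_at f"
  shows "convergent_at (\<lambda>x. c * f x)"
proof (rule convergent_at_le)
  show "(\<lambda>n. \<bar>c\<bar> * L1_norm \<mu> (\<lambda>x. Q n f x - f x)) \<longlonglongrightarrow> 0"
    using tendsto_mult[OF tendsto_const f(2)[unfolded convergent_at_def], of "\<bar>c\<bar>"] by simp
  fix n :: nat assume n: "1 \<le> n"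
  note int = f(1) integrable_Q[OF n f(1)] integrable_Q[OF n integrable_mult_right[OF f(1)]]
  have "AE x in \<mu>. Q n (\<lambda>x. c * f x) x = c * Q n f x"
    using linear[OF n] f(1) unfolding L1_linear_operator_def by blast
  then have "AE x in \<mu>. Q n (\<lambda>x. c * f x) x - c * f x = c * (Q n f x - f x)"
    by eventually_elim (simp add: right_diff_distrib)
  then have "L1_norm \<mu> (\<lambda>x. Q n (\<lambda>x. c * f x) x - c * f x) = L1_norm \<mu> (\<lambda>x. c * (Q n f x - f x))"
    using int by (intro L1_norm_cong_AE) auto
  then show "L1_norm \<mu> (\<lambda>x. Q n (\<lambda>x. c * f x) x - c * f x) \<le> \<bar>c\<bar> * L1_norm \<mu> (\<lambda>x. Q n f x - f x)"
    by (simp add: L1_norm_def abs_mult)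
qed

text \<open>An \<open>e / 3\<close> argument. The contraction property makes the error from
  replacing \<open>g\<close> by \<open>s i\<close> uniform in \<open>n\<close>, so \<open>i\<close>
  can be chosen before \<open>n\<close>.\<close>

lemma convergent_at_limit:
  assumes g: "integrable \<mu> g" and s: "\<And>i. integrable \<mu> (s i)" "\<And>i. convergent_at (s i)"
    and lim: "(\<lambda>i. L1_norm \<mu> (\<lambda>x. g x - s i x)) \<longlonglongrightarrow> 0"
  shows "convergent_at g"
  unfolding convergent_at_def
proof (rule order_tendstoI)
  fix e :: real assume "0 < e"
  then have "\<forall>\<^sub>F i in sequentially. L1_norm \<mu> (\<lambda>x. g x - s i x) < e / 3"
    by (intro order_tendstoD(2)[OF lim]) auto
  then obtain i where i: "L1_norm \<mu> (\<lambda>x. g x - s i x) < e / 3"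
    using eventually_happens' sequentially_bot by blast
  have "\<forall>\<^sub>F n in sequentially. L1_norm \<mu> (\<lambda>x. Q n (s i) x - s i x) < e / 3"
    using \<open>0 < e\<close> by (intro order_tendstoD(2)[OF s(2)[unfolded convergent_at_def]]) auto
  then show "\<forall>\<^sub>F n in sequentially. L1_norm \<mu> (\<lambda>x. Q n g x - g x) < e"
    using eventually_ge_at_top[of 1]
  proof eventually_elim
    case (elim n)
    note n = elim(2)
    note Q = integrable_Q[OF n]
    have "L1_norm \<mu> (\<lambda>x. Q n g x - g x) \<le>
        L1_norm \<mu> (\<lambda>x. Q n g x - Q n (s i) x) + L1_norm \<mu> (\<lambda>x. Q n (s i) x - g x)"
      by (intro L1_norm_diff_triangle Q g s)
    moreover have "L1_norm \<mu> (\<lambda>x. Q n (s i) x - g x) \<le>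
        L1_norm \<mu> (\<lambda>x. Q n (s i) x - s i x) + L1_norm \<mu> (\<lambda>x. s i x - g x)"
      by (intro L1_norm_diff_triangle Q g s)
    moreover have "L1_norm \<mu> (\<lambda>x. Q n g x - Q n (s i) x) \<le> L1_norm \<mu> (\<lambda>x. g x - s i x)"
      by (intro markov_operator_contraction_diff markov n g s)
    ultimately show ?case
      using i elim(1) L1_norm_minus_commute[of \<mu> g "s i"] by linarith
  qed
next
  fix a :: real assume "a < 0"
  then show "\<forall>\<^sub>F n in sequentially. a < L1_norm \<mu> (\<lambda>x. Q n g x - g x)"
    by (intro always_eventually allI less_le_trans[OF _ L1_norm_nonneg])
qed

end

lemma Qop_tendsto_id:
  fixes \<mu> :: "'a::metric_space measure"
  assumes bdd: "bounded (UNIV :: 'a set)" and sets: "sets \<mu> = sets borel"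
    and part: "\<And>n. 1 \<le> n \<Longrightarrow> partition_space \<mu> C n"
    and diam: "(\<lambda>n. Max ((\<lambda>i. diameter (C i n)) ` {1..n})) \<longlonglongrightarrow> 0"
    and f: "integrable \<mu> f"
  shows "(\<lambda>n. L1_norm \<mu> (\<lambda>x. Qop \<mu> C n f x - f x)) \<longlonglongrightarrow> 0"
proof -
  interpret prob_space \<mu> using part[of 1] by (simp add: partition_space_def)
  interpret markov_sequence \<mu> "Qop \<mu> C"
    by unfold_locales (rule partition_space.markov_Qop[OF part])
  let ?d = "\<lambda>n. Max ((\<lambda>i. diameter (C i n)) ` {1..n})"
  have space: "space \<mu> = UNIV" using sets_eq_imp_space_eq[OF sets] by simp
  have ind: "integrable \<mu> (indicat_real A)" if "A \<in> sets borel" for A :: "'a set"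
    using that sets by (auto simp: less_top[symmetric])
  have lipschitz: "convergent_at g"
    if g: "integrable \<mu> g" and L: "0 \<le> L" "\<And>x y. \<bar>g x - g y\<bar> \<le> L * dist x y" for g L
  proof (rule convergent_at_le)
    show "(\<lambda>n. L * ?d n) \<longlonglongrightarrow> 0"
      using tendsto_mult[OF tendsto_const diam, of L] by simp
    fix n :: nat assume n: "1 \<le> n"
    show "L1_norm \<mu> (\<lambda>x. Qop \<mu> C n g x - g x) \<le> L * ?d n"
    proof (rule partition_space.Qop_close[OF part[OF n] g])
      fix i x y assume i: "i \<in> {1..n}" and xy: "x \<in> C i n" "y \<in> C i n"
      \<comment> \<open>\<open>diameter\<close> bounds distances only on bounded sets; boundedness
        of the whole space supplies this for every cell.\<close>
      have "dist x y \<le> diameter (C i n)"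
        using bounded_subset[OF bdd] xy by (intro diameter_bounded_bound) auto
      also have "\<dots> \<le> ?d n" using i by (intro Max_ge) auto
      finally show "\<bar>g x - g y\<bar> \<le> L * ?d n"
        using L(1) by (intro order_trans[OF L(2)] mult_left_mono)
    qed
  qed
  \<comment> \<open>Constants are Lipschitz with \<open>L = 0\<close>.\<close>
  have zero: "convergent_at (\<lambda>x. 0)" by (rule lipschitz[of _ 0]) auto
  have empty: "convergent_at (indicat_real {})" by (rule lipschitz[of _ 0]) auto
  have closed_ind: "convergent_at (indicat_real F)" if F: "closed F" for F :: "'a set"
  \<comment> \<open>The empty set is treated apart because \<open>infdist x {}\<close> is 0 by
    convention, which would make every \<open>s k\<close> below constantly 1.\<close>
  proof (cases "F = {}")
    case False
    \<comment> \<open>A ramp equal to 1 on \<open>F\<close> with Lipschitz constant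
      \<open>k\<close>. For positive \<open>k\<close> it vanishes at distance at least
      \<open>1 / k\<close> from \<open>F\<close>, so closedness of \<open>F\<close> gives pointwise
      convergence to the indicator.\<close>
    define s where "s k x = max 0 (1 - real k * infdist x F)" for k x
    have s01: "0 \<le> s k x" "s k x \<le> 1" for k x by (auto simp: s_def infdist_nonneg)
    have "s k \<in> borel_measurable borel" for k
      unfolding s_def
      by (intro borel_measurable_continuous_onI continuous_intros)
    then have "s k \<in> borel_measurable \<mu>" for k
      using measurable_cong_sets[OF sets refl] by blast
    then have s: "integrable \<mu> (s k)" for k
      using s01 by (intro integrable_const_bound[where B = 1]) auto
    have F1: "s k x = 1" if "x \<in> F" for k x
      using that by (simp add: s_def)
    show ?thesis
    proof (rule convergent_at_limit[OF ind s])
      show "F \<in> sets borel" using F by simp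
      show "convergent_at (s k)" for k
      proof (rule lipschitz[OF s])
        fix x y
        have "\<bar>s k x - s k y\<bar> \<le> \<bar>real k * infdist x F - real k * infdist y F\<bar>"
          unfolding s_def by linarith
        also have "\<dots> = real k * \<bar>infdist x F - infdist y F\<bar>"
          by (simp add: abs_mult flip: right_diff_distrib)
        also have "\<dots> \<le> real k * dist x y" by (intro mult_left_mono infdist_triangle_abs) auto
        finally show "\<bar>s k x - s k y\<bar> \<le> real k * dist x y" .
      qed simp
      show "(\<lambda>k. L1_norm \<mu> (\<lambda>x. indicator F x - s k x)) \<longlonglongrightarrow> 0"
      proof (rule L1_norm_tendsto_dominated[OF ind s, where w = "\<lambda>_. 1"])
        show "(\<lambda>k. s k x) \<longlonglongrightarrow> indicator F x" for x
        proof (cases "x \<in> F")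
          case x: False
          then have "0 < infdist x F"
            using in_closed_iff_infdist_zero[OF F False, of x] infdist_nonneg[of x F] by linarith
          then obtain N :: nat where N: "1 < real N * infdist x F" using reals_Archimedean3 by blast
          have "s k x = 0" if "N \<le> k" for k
          proof -
            have "real N * infdist x F \<le> real k * infdist x F"
              using that by (intro mult_right_mono infdist_nonneg) auto
            then show ?thesis using N by (simp add: s_def)
          qed
          then show ?thesis using x
            by (intro tendsto_eventually) (auto simp: eventually_sequentially)
        qed (simp add: F1)
        show "\<bar>indicator F x - s k x\<bar> \<le> 1" for k x
          using s01[of k x] by (auto simp: indicator_def)
      qed (use F in auto)
    qed
  qed (simp add: zero empty)
  have borel_sigma: "sets (borel :: 'a measure) = sigma_sets UNIV (Collect closed)"
    unfolding borel_eq_closed by simp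
  have set_ind: "convergent_at (indicat_real A)" if "A \<in> sets borel" for A :: "'a set"
  proof -
    have "Int_stable (Collect closed :: 'a set set)" by (auto simp: Int_stable_def)
    moreover have "(Collect closed :: 'a set set) \<subseteq> Pow UNIV" by auto
    moreover have "A \<in> sigma_sets UNIV (Collect closed)" using that borel_sigma by simp
    ultimately show ?thesis
    \<comment> \<open>The pi-lambda theorem is used because only disjoint unions behave linearly:
      their indicators add, while complements become the constant 1 minus an indicator.\<close>
    proof (induct rule: sigma_sets_induct_disjoint)
      case (basic A)
      then show ?case by (simp add: closed_ind)
    next
      case empty
      show ?case by (simp add: zero empty)
    next
      case (compl A)
      then have A: "integrable \<mu> (indicat_real A)" using borel_sigma by (intro ind) simp
      have "convergent_at (\<lambda>x. indicator UNIV x + - 1 * indicator A x)"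
        by (intro convergent_at_add convergent_at_scale closed_ind closed_UNIV ind borel_closed
            integrable_mult_right A compl)
      also have "(\<lambda>x. indicator UNIV x + - 1 * indicator A x) = indicat_real (UNIV - A)"
        by (auto simp: indicator_def)
      finally show ?case .
    next
      case (union A)
      have A: "A i \<in> sets borel" for i using union(2) borel_sigma by auto
      have sA: "integrable \<mu> (indicat_real (\<Union>i<k. A i))" for k :: nat
        using A by (intro ind) auto
      show ?case
      proof (rule convergent_at_limit[OF ind sA])
        \<comment> \<open>Disjointness makes each finite partial union a sum of indicators; the
          countable union is then reached as an L1 limit.\<close>
        show "convergent_at (indicat_real (\<Union>i<k. A i))" for k :: nat
        proof (induct k)
          case (Suc k)
          have "A i \<inter> A k = {}" if "i < k" for i
            using disjoint_family_onD[OF union(1)] that by simp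
          then have disj: "(\<Union>i<k. A i) \<inter> A k = {}" by blast
          have "(\<Union>i<Suc k. A i) = (\<Union>i<k. A i) \<union> A k" by (auto simp: lessThan_Suc)
          then have "indicat_real (\<Union>i<Suc k. A i) = (\<lambda>x. indicator (\<Union>i<k. A i) x + indicator (A k) x)"
            by (simp add: indicator_add[OF disj])
          then show ?case
            by (simp only:) (intro convergent_at_add Suc sA union(3) ind A)
        qed (simp add: zero empty)
        show "(\<lambda>k. L1_norm \<mu> (\<lambda>x. indicator (\<Union>i. A i) x - indicator (\<Union>i<k. A i) x)) \<longlonglongrightarrow> 0"
        proof (rule L1_norm_tendsto_dominated[OF ind sA, where w = "\<lambda>_. 1"])
          show "(\<lambda>k. indicat_real (\<Union>i<k. A i) x) \<longlonglongrightarrow> indicator (\<Union>i. A i) x" for x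
            by (rule LIMSEQ_indicator_UN)
        qed (use A in \<open>auto simp: indicator_def\<close>)
      qed (use A in auto)
    qed
  qed
  from f have "convergent_at f"
  proof (induct rule: integrable_induct)
    case (base A c)
    then have A: "A \<in> sets borel" using sets by simp
    show ?case using convergent_at_scale[OF ind[OF A] set_ind[OF A], of c] by (simp add: mult.commute)
  next
    case (add f g)
    then show ?case by (intro convergent_at_add)
  next
    case (lim f s)
    show ?case
    proof (rule convergent_at_limit[OF lim(5,1,2)])
      show "(\<lambda>i. L1_norm \<mu> (\<lambda>x. f x - s i x)) \<longlonglongrightarrow> 0"
      \<comment> \<open>The factor 3 comes from the bound
        \<open>\<bar>s i x\<bar> \<le> 2 * \<bar>f x\<bar>\<close> supplied by
        \<open>integrable_induct\<close>, plus one more \<open>\<bar>f x\<bar>\<close> for the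
        difference.\<close>
      proof (rule L1_norm_tendsto_dominated[OF lim(5,1) _ lim(3), where w = "\<lambda>x. 3 * \<bar>f x\<bar>"])
        show "\<bar>f x - s i x\<bar> \<le> 3 * \<bar>f x\<bar>" if "x \<in> space \<mu>" for i x
          using lim(4)[OF that, of i] by simp
      qed (use lim(5) in auto)
    qed
  qed
  then show ?thesis by (simp add: convergent_at_def)
qed

text \<open>The reverse triangle inequality. It turns L1 convergence to \<open>v\<close> into the
  exact value of the limiting distance to \<open>w\<close>. Integrability of
  \<open>u \<epsilon>\<close> is required only eventually, since the approximations are controlled
  for positive \<open>\<epsilon>\<close>.\<close>

lemma L1_norm_tendsto_diff:
  assumes "\<forall>\<^sub>F \<epsilon> in F. integrable \<mu> (u \<epsilon>)" and v: "integrable \<mu> v" and w: "integrable \<mu> w"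
    and lim: "((\<lambda>\<epsilon>. L1_norm \<mu> (\<lambda>x. u \<epsilon> x - v x)) \<longlongrightarrow> 0) F"
  shows "((\<lambda>\<epsilon>. L1_norm \<mu> (\<lambda>x. u \<epsilon> x - w x)) \<longlongrightarrow> L1_norm \<mu> (\<lambda>x. v x - w x)) F"
proof (rule Lim_transform_bound[THEN LIM_zero_cancel, OF _ lim])
  show "\<forall>\<^sub>F \<epsilon> in F. norm (L1_norm \<mu> (\<lambda>x. u \<epsilon> x - w x) - L1_norm \<mu> (\<lambda>x. v x - w x)) \<le>
      norm (L1_norm \<mu> (\<lambda>x. u \<epsilon> x - v x))"
    using assms(1)
  proof eventually_elim
    case (elim \<epsilon>)
    show ?case
      using L1_norm_diff_triangle[OF elim v w] L1_norm_diff_triangle[OF v elim w]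
        L1_norm_minus_commute[of \<mu> v "u \<epsilon>"] L1_norm_nonneg[of \<mu> "\<lambda>x. u \<epsilon> x - v x"]
      by (simp add: abs_le_iff)
  qed
qed

text \<open>The sequence \<open>l\<close> of inner limits makes their existence for every
  \<open>n\<close> from 1 on part of the claim.\<close>

theorem theorem4p3:
  fixes \<mu> :: "'a::metric_space measure"
    and T :: "'a \<Rightarrow> 'a"
    and P :: "('a \<Rightarrow> real) \<Rightarrow> ('a \<Rightarrow> real)"
    and C :: "nat \<Rightarrow> nat \<Rightarrow> 'a set"
    and \<psi> :: "real \<Rightarrow> nat \<Rightarrow> nat \<Rightarrow> 'a \<Rightarrow> real"
  assumes "compact (UNIV :: 'a set)"
    and "prob_space \<mu>" and "sets \<mu> = sets borel"
    and "T \<in> measurable \<mu> \<mu>" and "nonsingular \<mu> T"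
    and "perron_frobenius \<mu> T P"
    and "\<And>n i. 1 \<le> n \<Longrightarrow> i \<in> {1..n} \<Longrightarrow> C i n \<in> sets \<mu>"
    and "\<And>n i j. 1 \<le> n \<Longrightarrow> i \<in> {1..n} \<Longrightarrow> j \<in> {1..n} \<Longrightarrow> i \<noteq> j \<Longrightarrow> C i n \<inter> C j n = {}"
    and "\<And>n. 1 \<le> n \<Longrightarrow> (\<Union>i\<in>{1..n}. C i n) = UNIV"
    and "\<And>n i. 1 \<le> n \<Longrightarrow> i \<in> {1..n} \<Longrightarrow> measure \<mu> (C i n) > 0"
    and "(\<lambda>n. Max ((\<lambda>i. diameter (C i n)) ` {1..n})) \<longlonglongrightarrow> 0"
    and "\<And>\<epsilon> n i. 0 < \<epsilon> \<Longrightarrow> 1 \<le> n \<Longrightarrow> i \<in> {1..n} \<Longrightarrow>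
           integrable \<mu> (\<psi> \<epsilon> i n) \<and> \<psi> \<epsilon> i n \<in> L_infinity \<mu>"
    and "\<And>\<epsilon> n i x. 0 < \<epsilon> \<Longrightarrow> 1 \<le> n \<Longrightarrow> i \<in> {1..n} \<Longrightarrow> \<psi> \<epsilon> i n x \<ge> 0"
    and "\<And>\<epsilon> n x. 0 < \<epsilon> \<Longrightarrow> 1 \<le> n \<Longrightarrow> (\<Sum>i=1..n. \<psi> \<epsilon> i n x) = 1"
    and "\<And>n i. 1 \<le> n \<Longrightarrow> i \<in> {1..n} \<Longrightarrow>
           (AE x in \<mu>. ((\<lambda>\<epsilon>. \<psi> \<epsilon> i n x) \<longlongrightarrow> indicator (C i n) x) (at_right 0))"
  shows "(\<forall>\<epsilon>>0. \<forall>n\<ge>1. markov_operator \<mu> (reg_approx \<mu> T C \<psi> n \<epsilon>)) \<and>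
    (\<forall>f. integrable \<mu> f \<longrightarrow>
      (\<exists>l :: nat \<Rightarrow> real.
        (\<forall>n\<ge>1. ((\<lambda>\<epsilon>. L1_norm \<mu> (\<lambda>x. reg_approx \<mu> T C \<psi> n \<epsilon> f x - P f x)) \<longlongrightarrow> l n) (at_right 0)) \<and>
        l \<longlonglongrightarrow> 0))"
proof -
  note C_sets = assms(7) and C_disj = assms(8) and C_cover = assms(9) and C_pos = assms(10)
    and psi_int = assms(12) and psi_nn = assms(13) and psi_sum = assms(14) and psi_lim = assms(15)
  interpret prob_space \<mu> by fact
  have space: "space \<mu> = UNIV" using sets_eq_imp_space_eq[OF assms(3)] by simp
  have part: "partition_space \<mu> C n" if "1 \<le> n" for n
    using C_sets[OF that] C_disj[OF that] C_cover[OF that] C_pos[OF that]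
    by unfold_locales (auto simp: space)
  have reg: "regularized_partition \<mu> C n T \<psi>" if "1 \<le> n" for n
    using part[OF that] assms(4) psi_int[OF _ that] psi_nn[OF _ that] psi_sum[OF _ that]
    by (intro regularized_partition.intro regularized_partition_axioms.intro) auto
  note markov_reg = regularized_partition.markov_reg_approx[OF reg]
  have markov_P: "markov_operator \<mu> P" by (rule perron_frobenius_markov) fact+
  have linear: "integrable \<mu> (R g)" if "markov_operator \<mu> R" "integrable \<mu> g" for R g
    using that by (simp add: markov_operator_def L1_linear_operator_integrable)
  have "\<exists>l. (\<forall>n\<ge>1. ((\<lambda>\<epsilon>. L1_norm \<mu> (\<lambda>x. reg_approx \<mu> T C \<psi> n \<epsilon> f x - P f x)) \<longlongrightarrow> l n)
      (at_right 0)) \<and> l \<longlonglongrightarrow> 0" if f: "integrable \<mu> f" for f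
  proof (intro exI conjI allI impI)
    let ?Q = "Qop \<mu> C"
    \<comment> \<open>This is the witness for \<open>l\<close>: the inner limit need not vanish, and
      it is the error of the unregularised scheme at level \<open>n\<close>.\<close>
    let ?l = "\<lambda>n. L1_norm \<mu> (\<lambda>x. ?Q n (P (?Q n f)) x - P f x)"
    have Pf: "integrable \<mu> (P f)" by (rule linear[OF markov_P f])
    have Q: "markov_operator \<mu> (?Q n)" if "1 \<le> n" for n
      by (rule partition_space.markov_Qop[OF part[OF that]])
    have Qf: "integrable \<mu> (?Q n f)" if "1 \<le> n" for n by (rule linear[OF Q[OF that] f])
    have PQf: "integrable \<mu> (P (?Q n f))" if "1 \<le> n" for n by (rule linear[OF markov_P Qf[OF that]])
    fix n :: nat assume n: "1 \<le> n"
    show "((\<lambda>\<epsilon>. L1_norm \<mu> (\<lambda>x. reg_approx \<mu> T C \<psi> n \<epsilon> f x - P f x)) \<longlongrightarrow> ?l n) (at_right 0)"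
    proof (rule L1_norm_tendsto_diff[OF _ linear[OF Q[OF n] PQf[OF n]] Pf])
      show "\<forall>\<^sub>F \<epsilon> in at_right 0. integrable \<mu> (reg_approx \<mu> T C \<psi> n \<epsilon> f)"
        using eventually_at_right_less[of 0] by eventually_elim (rule linear[OF markov_reg[OF n] f])
    qed (rule regularized_partition.reg_approx_tendsto[OF reg[OF n] assms(5,6) f psi_lim[OF n]])
  next
    let ?Q = "Qop \<mu> C"
    let ?l = "\<lambda>n. L1_norm \<mu> (\<lambda>x. ?Q n (P (?Q n f)) x - P f x)"
    have Pf: "integrable \<mu> (P f)" by (rule linear[OF markov_P f])
    have Q_id: "(\<lambda>n. L1_norm \<mu> (\<lambda>x. ?Q n g x - g x)) \<longlonglongrightarrow> 0" if "integrable \<mu> g" for g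
      by (rule Qop_tendsto_id[OF compact_imp_bounded[OF assms(1)] assms(3) part assms(11) that])
    have bound: "?l n \<le> L1_norm \<mu> (\<lambda>x. ?Q n f x - f x) + L1_norm \<mu> (\<lambda>x. ?Q n (P f) x - P f x)"
      if n: "1 \<le> n" for n
    proof -
      note Q = partition_space.markov_Qop[OF part[OF n]]
      have Qf: "integrable \<mu> (?Q n f)" by (rule linear[OF Q f])
      have PQf: "integrable \<mu> (P (?Q n f))" by (rule linear[OF markov_P Qf])
      \<comment> \<open>\<open>?Q n (P f)\<close> is inserted as an intermediate point. The first
        term then shrinks under two contractions, first removing \<open>?Q n\<close> and then
        \<open>P\<close>, which leaves only averaging errors of the fixed functions \<open>f\<close>
        and \<open>P f\<close>.\<close>
      have "?l n \<le> L1_norm \<mu> (\<lambda>x. ?Q n (P (?Q n f)) x - ?Q n (P f) x) +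
          L1_norm \<mu> (\<lambda>x. ?Q n (P f) x - P f x)"
        by (intro L1_norm_diff_triangle linear[OF Q] PQf Pf)
      moreover have "L1_norm \<mu> (\<lambda>x. ?Q n (P (?Q n f)) x - ?Q n (P f) x) \<le>
          L1_norm \<mu> (\<lambda>x. P (?Q n f) x - P f x)"
        by (rule markov_operator_contraction_diff[OF Q PQf Pf])
      moreover have "\<dots> \<le> L1_norm \<mu> (\<lambda>x. ?Q n f x - f x)"
        by (rule markov_operator_contraction_diff[OF markov_P Qf f])
      ultimately show ?thesis by linarith
    qed
    show "?l \<longlonglongrightarrow> 0"
    proof (rule tendsto_sandwich[OF _ _ tendsto_const])
      show "\<forall>\<^sub>F n in sequentially. ?l n \<le>
          L1_norm \<mu> (\<lambda>x. ?Q n f x - f x) + L1_norm \<mu> (\<lambda>x. ?Q n (P f) x - P f x)"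
        using eventually_ge_at_top[of 1] by eventually_elim (rule bound)
      show "(\<lambda>n. L1_norm \<mu> (\<lambda>x. ?Q n f x - f x) + L1_norm \<mu> (\<lambda>x. ?Q n (P f) x - P f x)) \<longlonglongrightarrow> 0"
        using tendsto_add[OF Q_id[OF f] Q_id[OF Pf]] by simp
    qed (intro always_eventually allI L1_norm_nonneg)
  qed
  then show ?thesis using markov_reg by blast
qed

end
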